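(* The selfadjoint elements of $\mathrm{Alg}\,\mathcal{L}$ are real multiples of the identity.
   Context: $H^2(\mathbb{R})\subset L^2(\mathbb{R})$ is the Hardy space of the upper half plane. $\mathcal{L}$ is the lattice of closed subspaces of $L^2(\mathbb{R})$ $$\mathcal{L}=\{0\}\cup\{L^2(-\alpha,\infty):\alpha\ge0\}\cup\{e^{i\beta x}H^2(\mathbb{R}):\beta\ge0\}\cup\{L^2(\mathbb{R})\},$$ and $\mathrm{Alg}\,\mathcal{L}$ is the algebra of all bounded operators on $L^2(\mathbb{R})$ that leave every subspace in $\mathcal{L}$ invariant. *)

theory Defs
  imports "HOL-Complex_Analysis.Complex_Analysis"
begin

section \<open>The Hilbert space of square-integrable complex functions on the line\<close>

definition square_integrable :: "(real \<Rightarrow> complex) \<Rightarrow> bool" where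
  "square_integrable f \<longleftrightarrow>
     f \<in> borel_measurable lborel \<and> integrable lborel (\<lambda>x. (cmod (f x))\<^sup>2)"

lemma square_integrable_0 [simp]: "square_integrable (\<lambda>x. 0)"
  by (simp add: square_integrable_def)

lemma square_integrable_dominated:
  assumes "square_integrable f" "g \<in> borel_measurable lborel"
    "\<And>x. cmod (g x) \<le> C * cmod (f x)"
  shows "square_integrable g"
proof -
  have "integrable lborel (\<lambda>x. C\<^sup>2 * (cmod (f x))\<^sup>2)"
    using assms(1) by (simp add: square_integrable_def)
  moreover have "(cmod (g x))\<^sup>2 \<le> C\<^sup>2 * (cmod (f x))\<^sup>2" for x
    using power_mono[OF assms(3)[of x] norm_ge_zero, of 2] by (simp add: power_mult_distrib)
  ultimately have "integrable lborel (\<lambda>x. (cmod (g x))\<^sup>2)"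
    using assms(2) by (elim Bochner_Integration.integrable_bound) auto
  with assms(2) show ?thesis by (simp add: square_integrable_def)
qed

lemma square_integrable_cmult:
  assumes "square_integrable f"
  shows "square_integrable (\<lambda>x. c * f x)"
  using assms by (intro square_integrable_dominated[OF assms, where C = "cmod c"])
    (auto simp: square_integrable_def norm_mult)

lemma square_integrable_add:
  assumes "square_integrable f" "square_integrable g"
  shows "square_integrable (\<lambda>x. f x + g x)"
proof -
  have m: "f \<in> borel_measurable lborel" "g \<in> borel_measurable lborel"
    using assms by (auto simp: square_integrable_def)
  have "(cmod (f x + g x))\<^sup>2 \<le> 2 * (cmod (f x))\<^sup>2 + 2 * (cmod (g x))\<^sup>2" for x
  proof -
    have "(cmod (f x + g x))\<^sup>2 \<le> (cmod (f x) + cmod (g x))\<^sup>2"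
      by (intro power_mono norm_triangle_ineq) auto
    also have "\<dots> \<le> 2 * (cmod (f x))\<^sup>2 + 2 * (cmod (g x))\<^sup>2"
      using sum_squares_bound[of "cmod (f x)" "cmod (g x)"] by (simp add: power2_sum)
    finally show ?thesis .
  qed
  moreover have "integrable lborel (\<lambda>x. 2 * (cmod (f x))\<^sup>2 + 2 * (cmod (g x))\<^sup>2)"
    using assms by (simp add: square_integrable_def)
  ultimately have "integrable lborel (\<lambda>x. (cmod (f x + g x))\<^sup>2)"
    using m by (elim Bochner_Integration.integrable_bound) auto
  with m show ?thesis by (simp add: square_integrable_def)
qed

lemma square_integrable_mult_cnj:
  assumes "square_integrable f" "square_integrable g"
  shows "integrable lborel (\<lambda>x. f x * cnj (g x))"
proof (rule Bochner_Integration.integrable_bound)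
  show "integrable lborel (\<lambda>x. (cmod (f x))\<^sup>2 + (cmod (g x))\<^sup>2)"
    using assms by (simp add: square_integrable_def)
  have [measurable]: "f \<in> borel_measurable lborel" "g \<in> borel_measurable lborel"
    using assms by (auto simp: square_integrable_def)
  show "(\<lambda>x. f x * cnj (g x)) \<in> borel_measurable lborel"
    by (intro borel_measurable_times borel_measurable_continuous_on[where f = cnj]) 
       (auto intro!: continuous_intros)
  show "AE x in lborel. norm (f x * cnj (g x)) \<le> norm ((cmod (f x))\<^sup>2 + (cmod (g x))\<^sup>2)"
  proof (rule AE_I2)
    fix x
    have "cmod (f x) * cmod (g x) \<le> (cmod (f x))\<^sup>2 + (cmod (g x))\<^sup>2"
      using sum_squares_bound[of "cmod (f x)" "cmod (g x)"]
        mult_nonneg_nonneg[OF norm_ge_zero[of "f x"] norm_ge_zero[of "g x"]]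
      unfolding mult.assoc by linarith
    then show "norm (f x * cnj (g x)) \<le> norm ((cmod (f x))\<^sup>2 + (cmod (g x))\<^sup>2)"
      by (simp add: norm_mult)
  qed
qed

quotient_type L2R = "real \<Rightarrow> complex" / partial:
  "\<lambda>f g. square_integrable f \<and> square_integrable g \<and> (AE x in lborel. f x = g x)"
proof (rule part_equivpI)
  show "\<exists>f. square_integrable f \<and> square_integrable f \<and> (AE x in lborel. f x = f x)"
    by (rule exI[of _ "\<lambda>x. 0"]) simp
qed (auto intro!: sympI transpI elim: eventually_elim2 eventually_mono)

instantiation L2R :: ab_group_add
begin

lift_definition zero_L2R :: L2R is "\<lambda>x. 0" by simp

lift_definition plus_L2R :: "L2R \<Rightarrow> L2R \<Rightarrow> L2R" is "\<lambda>f g x. f x + g x"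
  by (auto intro: square_integrable_add elim: eventually_elim2)

lift_definition uminus_L2R :: "L2R \<Rightarrow> L2R" is "\<lambda>f x. - f x"
  using square_integrable_cmult[where c = "-1"] by (auto elim: eventually_mono)

definition minus_L2R :: "L2R \<Rightarrow> L2R \<Rightarrow> L2R" where
  "minus_L2R f g = f + (- g)"

instance
proof
  fix a b c :: L2R
  show "a + b + c = a + (b + c)"
    by transfer (simp add: square_integrable_add add.assoc)
  show "a + b = b + a"
    by transfer (simp add: square_integrable_add add.commute)
  show "0 + a = a"
    by transfer simp
  show "- a + a = 0"
    by transfer simp
  show "a - b = a + - b"
    by (simp add: minus_L2R_def)
qed

end

lift_definition scaleC :: "complex \<Rightarrow> L2R \<Rightarrow> L2R" (infixr "*\<^sub>C" 75) is "\<lambda>c f x. c * f x"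
  by (auto intro: square_integrable_cmult elim: eventually_mono)

lift_definition cinner :: "L2R \<Rightarrow> L2R \<Rightarrow> complex" is
  "\<lambda>f g. \<integral>x. f x * cnj (g x) \<partial>lborel"
proof -
  fix f f' g g' :: "real \<Rightarrow> complex"
  assume f: "square_integrable f \<and> square_integrable f' \<and> (AE x in lborel. f x = f' x)"
    and g: "square_integrable g \<and> square_integrable g' \<and> (AE x in lborel. g x = g' x)"
  have "AE x in lborel. f x * cnj (g x) = f' x * cnj (g' x)"
    using f g by (auto elim: eventually_elim2)
  then show "(\<integral>x. f x * cnj (g x) \<partial>lborel) = (\<integral>x. f' x * cnj (g' x) \<partial>lborel)"
    using f g by (intro integral_cong_AE borel_measurable_integrable square_integrable_mult_cnj) auto
qed

lemma cinner_add_left: "cinner (f + g) h = cinner f h + cinner g h"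
  by transfer (simp add: distrib_right square_integrable_mult_cnj)

lemma cinner_scaleC_left: "cinner (c *\<^sub>C f) g = c * cinner f g"
  by transfer (simp add: mult.assoc)

lemma cinner_commute: "cinner f g = cnj (cinner g f)"
proof transfer
  fix f g :: "real \<Rightarrow> complex"
  have "(\<lambda>x. cnj (g x * cnj (f x))) = (\<lambda>x. f x * cnj (g x))"
    by (simp add: fun_eq_iff mult.commute)
  then show "(\<integral>x. f x * cnj (g x) \<partial>lborel) = cnj (\<integral>x. g x * cnj (f x) \<partial>lborel)"
    using Bochner_Integration.integral_cnj[of lborel "\<lambda>x. g x * cnj (f x)"] by metis
qed

lemma cinner_self:
  "cinner f f = complex_of_real (Re (cinner f f))" "0 \<le> Re (cinner f f)"
  "cinner f f = 0 \<longleftrightarrow> f = 0"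
proof -
  have *: "(\<integral>x. h x * cnj (h x) \<partial>lborel) = complex_of_real (\<integral>x. (cmod (h x))\<^sup>2 \<partial>lborel)"
    for h :: "real \<Rightarrow> complex"
    by (simp only: complex_norm_square[symmetric] of_real_power[symmetric] integral_complex_of_real)
  show "cinner f f = complex_of_real (Re (cinner f f))"
    by transfer (simp only: * Re_complex_of_real)
  show "0 \<le> Re (cinner f f)"
    by transfer (simp add: *)
  show "cinner f f = 0 \<longleftrightarrow> f = 0"
  proof transfer
    fix f assume f: "square_integrable f \<and> square_integrable f \<and> (AE x in lborel. f x = f x)"
    have "(\<integral>x. (cmod (f x))\<^sup>2 \<partial>lborel) = 0 \<longleftrightarrow> (AE x in lborel. (cmod (f x))\<^sup>2 = 0)"
      using f by (intro integral_nonneg_eq_0_iff_AE) (auto simp: square_integrable_def)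
    then show "(\<integral>x. f x * cnj (f x) \<partial>lborel) = 0 \<longleftrightarrow>
        (square_integrable f \<and> square_integrable (\<lambda>x. 0) \<and> (AE x in lborel. f x = 0))"
      using f by (simp add: *)
  qed
qed

instantiation L2R :: real_inner
begin

definition scaleR_L2R :: "real \<Rightarrow> L2R \<Rightarrow> L2R" where
  "scaleR_L2R r f = complex_of_real r *\<^sub>C f"

definition inner_L2R :: "L2R \<Rightarrow> L2R \<Rightarrow> real" where
  "inner_L2R f g = Re (cinner f g)"

definition norm_L2R :: "L2R \<Rightarrow> real" where
  "norm_L2R f = sqrt (inner f f)"

definition sgn_L2R :: "L2R \<Rightarrow> L2R" where
  "sgn_L2R f = inverse (norm f) *\<^sub>R f"

definition dist_L2R :: "L2R \<Rightarrow> L2R \<Rightarrow> real" where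
  "dist_L2R f g = norm (f - g)"

definition uniformity_L2R :: "(L2R \<times> L2R) filter" where
  "uniformity_L2R = (INF e\<in>{0 <..}. principal {(x, y). dist x y < e})"

definition open_L2R :: "L2R set \<Rightarrow> bool" where
  "open_L2R U \<longleftrightarrow> (\<forall>x\<in>U. eventually (\<lambda>(x', y). x' = x \<longrightarrow> y \<in> U) uniformity)"

instance
proof
  fix f g h :: L2R and a b r :: real and U :: "L2R set"
  show "a *\<^sub>R (f + g) = a *\<^sub>R f + a *\<^sub>R g"
    unfolding scaleR_L2R_def
    by transfer (simp add: distrib_left square_integrable_add square_integrable_cmult)
  show "(a + b) *\<^sub>R f = a *\<^sub>R f + b *\<^sub>R f"
    unfolding scaleR_L2R_def
    by transfer (simp add: distrib_right square_integrable_add square_integrable_cmult)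
  show "a *\<^sub>R b *\<^sub>R f = (a * b) *\<^sub>R f"
    unfolding scaleR_L2R_def
    by transfer (simp add: square_integrable_cmult mult.assoc)
  show "1 *\<^sub>R f = f"
    unfolding scaleR_L2R_def by transfer simp
  show "dist f g = norm (f - g)" by (rule dist_L2R_def)
  show "sgn f = inverse (norm f) *\<^sub>R f" by (rule sgn_L2R_def)
  show "uniformity = (INF e\<in>{0 <..}. principal {(x::L2R, y). dist x y < e})"
    by (rule uniformity_L2R_def)
  show "open U \<longleftrightarrow> (\<forall>x\<in>U. \<forall>\<^sub>F (x', y) in uniformity. x' = x \<longrightarrow> y \<in> U)"
    by (rule open_L2R_def)
  show "inner f g = inner g f"
    unfolding inner_L2R_def by (subst cinner_commute) simp
  show "inner (f + g) h = inner f h + inner g h"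
    by (simp add: inner_L2R_def cinner_add_left)
  show "inner (r *\<^sub>R f) g = r * inner f g"
    by (simp add: inner_L2R_def scaleR_L2R_def cinner_scaleC_left)
  show "0 \<le> inner f f"
    unfolding inner_L2R_def by (rule cinner_self(2))
  show "inner f f = 0 \<longleftrightarrow> f = 0"
    using arg_cong[OF cinner_self(1)[of f], of "\<lambda>z. z = 0"] cinner_self(3)[of f]
    unfolding inner_L2R_def by (simp only: of_real_eq_0_iff)
  show "norm f = sqrt (inner f f)" by (rule norm_L2R_def)
qed

end

section \<open>The subspace lattice\<close>

lift_definition vanishes_off :: "real set \<Rightarrow> L2R \<Rightarrow> bool" is
  "\<lambda>S f. AE x in lborel. x \<notin> S \<longrightarrow> f x = 0"
proof -
  fix S :: "real set" and f g :: "real \<Rightarrow> complex"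
  assume "square_integrable f \<and> square_integrable g \<and> (AE x in lborel. f x = g x)"
  then have "AE x in lborel. f x = g x" by simp
  then have "AE x in lborel. (x \<notin> S \<longrightarrow> f x = 0) \<longleftrightarrow> (x \<notin> S \<longrightarrow> g x = 0)"
    by (elim eventually_mono) simp
  then show "(AE x in lborel. x \<notin> S \<longrightarrow> f x = 0) = (AE x in lborel. x \<notin> S \<longrightarrow> g x = 0)"
    by (rule eventually_subst)
qed

definition L2_on :: "real set \<Rightarrow> L2R set" where
  "L2_on S = {f. vanishes_off S f}"

definition upper_half_plane :: "complex set" where
  "upper_half_plane = {z. Im z > 0}"

definition hardy_function :: "(complex \<Rightarrow> complex) \<Rightarrow> bool" where
  "hardy_function F \<longleftrightarrow> F holomorphic_on upper_half_plane \<and>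
     (\<exists>C::real. \<forall>y>0. (\<integral>\<^sup>+x. ennreal ((cmod (F (Complex x y)))\<^sup>2) \<partial>lborel) \<le> ennreal C)"

text \<open>The boundary value of a Hardy function is its limit in \<open>L\<^sup>2\<close> norm along the horizontal lines
  \<open>Im z = y\<close> as \<open>y\<close> decreases to \<open>0\<close>; this identifies the Hardy space with a subspace of \<open>L\<^sup>2\<close>.\<close>

lift_definition boundary_value :: "(complex \<Rightarrow> complex) \<Rightarrow> L2R \<Rightarrow> bool" is
  "\<lambda>F f. ((\<lambda>y. \<integral>\<^sup>+x. ennreal ((cmod (F (Complex x y) - f x))\<^sup>2) \<partial>lborel) \<longlongrightarrow> 0) (at_right 0)"
proof -
  fix F :: "complex \<Rightarrow> complex" and f g :: "real \<Rightarrow> complex"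
  assume "square_integrable f \<and> square_integrable g \<and> (AE x in lborel. f x = g x)"
  then have "AE x in lborel. f x = g x" by simp
  then have "(\<integral>\<^sup>+x. ennreal ((cmod (F (Complex x y) - f x))\<^sup>2) \<partial>lborel) =
      (\<integral>\<^sup>+x. ennreal ((cmod (F (Complex x y) - g x))\<^sup>2) \<partial>lborel)" for y
    by (intro nn_integral_cong_AE) (auto elim: eventually_mono)
  then show "((\<lambda>y. \<integral>\<^sup>+x. ennreal ((cmod (F (Complex x y) - f x))\<^sup>2) \<partial>lborel) \<longlongrightarrow> 0) (at_right 0) =
      ((\<lambda>y. \<integral>\<^sup>+x. ennreal ((cmod (F (Complex x y) - g x))\<^sup>2) \<partial>lborel) \<longlongrightarrow> 0) (at_right 0)"
    by simp
qed

definition H2 :: "L2R set" where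
  "H2 = {f. \<exists>F. hardy_function F \<and> boundary_value F f}"

lift_definition modulate :: "real \<Rightarrow> L2R \<Rightarrow> L2R" is
  "\<lambda>\<beta> f x. exp (\<i> * of_real (\<beta> * x)) * f x"
proof -
  fix \<beta> :: real and f g :: "real \<Rightarrow> complex"
  assume fg: "square_integrable f \<and> square_integrable g \<and> (AE x in lborel. f x = g x)"
  have "square_integrable (\<lambda>x. exp (\<i> * of_real (\<beta> * x)) * h x)" if "square_integrable h" for h
  proof (rule square_integrable_dominated[OF that, where C = 1])
    have "(\<lambda>x. exp (\<i> * of_real (\<beta> * x))) \<in> borel_measurable borel"
      by (intro borel_measurable_continuous_onI continuous_intros)
    with that show "(\<lambda>x. exp (\<i> * of_real (\<beta> * x)) * h x) \<in> borel_measurable lborel"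
      by (auto simp: square_integrable_def intro!: borel_measurable_times)
  qed (simp add: norm_mult)
  with fg show "square_integrable (\<lambda>x. exp (\<i> * of_real (\<beta> * x)) * f x) \<and>
      square_integrable (\<lambda>x. exp (\<i> * of_real (\<beta> * x)) * g x) \<and>
      (AE x in lborel. exp (\<i> * of_real (\<beta> * x)) * f x = exp (\<i> * of_real (\<beta> * x)) * g x)"
    by (auto elim: eventually_mono)
qed

definition subspace_lattice :: "L2R set set" where
  "subspace_lattice =
     {{0}} \<union> {L2_on {-\<alpha><..} |\<alpha>. \<alpha> \<ge> 0} \<union> {modulate \<beta> ` H2 |\<beta>. \<beta> \<ge> 0} \<union> {UNIV}"

section \<open>Operators\<close>

definition bounded_clinear :: "(L2R \<Rightarrow> L2R) \<Rightarrow> bool" where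
  "bounded_clinear A \<longleftrightarrow> bounded_linear A \<and> (\<forall>c f. A (c *\<^sub>C f) = c *\<^sub>C A f)"

definition Alg :: "L2R set set \<Rightarrow> (L2R \<Rightarrow> L2R) set" where
  "Alg \<L> = {A. bounded_clinear A \<and> (\<forall>S\<in>\<L>. A ` S \<subseteq> S)}"

definition selfadjoint :: "(L2R \<Rightarrow> L2R) \<Rightarrow> bool" where
  "selfadjoint A \<longleftrightarrow> (\<forall>f g. cinner (A f) g = cinner f (A g))"

end

theory Submission
  imports Defs "HOL-Probability.Sinc_Integral"
begin

text \<open>A selfadjoint operator \<open>A\<close> that leaves a closed subspace invariant also leaves its orthogonal complement
invariant. Applied to the two families in the lattice this gives two kinds of rigidity, which can only
be reconciled by a scalar.

Invariance of the spaces \<open>L\<^sup>2(-\<alpha>,\<infinity>)\<close> makes \<open>A\<close> commute with cutting off at \<open>-\<alpha>\<close>, so that \<open>A\<close> acts on the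
negative half-line as multiplication by a real function. In symmetric form, which avoids naming the multiplier:
\<open>(A f) \<cdot> cnj g = f \<cdot> cnj (A g)\<close> almost everywhere on \<open>(-\<infinity>,0)\<close> (\<open>selfadjoint_Alg_local\<close>).

Invariance of \<open>H\<^sup>2\<close> is exploited through the Szego kernels \<open>k\<^sub>w(x) = 1/(x - cnj w)\<close>, \<open>Im w > 0\<close>, which lie in \<open>H\<^sup>2\<close>.
The inner product of \<open>f\<close> with \<open>k\<^sub>w\<close> is the Cauchy transform \<open>\<integral> f(x)/(x - w) dx\<close>, and for \<open>f \<in> H\<^sup>2\<close> this
integral vanishes when \<open>w\<close> is in the lower half plane. By locality the functions \<open>(x - cnj w) (A k\<^sub>w)(x)\<close>
for different \<open>w\<close> agree on the negative half-line. A function on the line whose Cauchy transform vanishes on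
an open set of nonreal points and which vanishes on the negative half-line is zero
(\<open>cauchy_transform_uniqueness\<close>: the transform extends holomorphically across the negative half-line),
so they agree everywhere. Hence \<open>(v - cnj w) \<langle>A k\<^sub>w, k\<^sub>v\<rangle>\<close> depends on \<open>v\<close> only, say it equals \<open>m(v)\<close>, and
selfadjointness reads \<open>cnj (m(w)) = - m(v)\<close> for all \<open>w\<close>, \<open>v\<close>. So \<open>m\<close> is an imaginary constant
(\<open>selfadjoint_Alg_szego_kernel\<close>). The identity operator gives a nonzero imaginary constant of the same kind, and
with \<open>c\<close> the real quotient of the two constants, \<open>A k\<^sub>w - c k\<^sub>w\<close> is orthogonal to the
kernels of the upper half plane; as an element of \<open>H\<^sup>2\<close> it is orthogonal to those of the lower half plane as well. The
kernels of both half planes together are total, by Poisson's formula, so \<open>A k\<^sub>w = c k\<^sub>w\<close>.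

Finally, for arbitrary \<open>f\<close> the element \<open>A f - c f\<close> is orthogonal to every \<open>k\<^sub>w\<close> because \<open>A\<close> is selfadjoint, and it
vanishes on the negative half-line by locality against a single kernel. The uniqueness theorem shows that it is zero.\<close>

section \<open>Square-integrable functions\<close>

lemma cauchy_schwarz_square_integrable:
  assumes f: "square_integrable f" and g: "square_integrable g"
  shows "(\<integral>x. cmod (f x) * cmod (g x) \<partial>lborel)\<^sup>2 \<le>
           (\<integral>x. (cmod (f x))\<^sup>2 \<partial>lborel) * (\<integral>x. (cmod (g x))\<^sup>2 \<partial>lborel)"
proof -
  have [measurable]: "f \<in> borel_measurable borel" "g \<in> borel_measurable borel"
    and if2: "integrable lborel (\<lambda>x. (cmod (f x))\<^sup>2)" and ig2: "integrable lborel (\<lambda>x. (cmod (g x))\<^sup>2)"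
    using f g by (auto simp: square_integrable_def)
  have ifg: "integrable lborel (\<lambda>x. cmod (f x) * cmod (g x))"
    using integrable_norm[OF square_integrable_mult_cnj[OF f g]] by (simp add: norm_mult)
  have "(\<integral>\<^sup>+x. ennreal (cmod (f x)) * ennreal (cmod (g x)) \<partial>lborel)\<^sup>2 \<le>
      (\<integral>\<^sup>+x. (ennreal (cmod (f x)))\<^sup>2 \<partial>lborel) * (\<integral>\<^sup>+x. (ennreal (cmod (g x)))\<^sup>2 \<partial>lborel)"
    by (rule Cauchy_Schwarz_nn_integral) auto
  then have "(\<integral>\<^sup>+x. ennreal (cmod (f x) * cmod (g x)) \<partial>lborel)\<^sup>2 \<le>
      (\<integral>\<^sup>+x. ennreal ((cmod (f x))\<^sup>2) \<partial>lborel) * (\<integral>\<^sup>+x. ennreal ((cmod (g x))\<^sup>2) \<partial>lborel)"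
    by (simp add: ennreal_mult ennreal_power)
  then show ?thesis
    by (simp add: nn_integral_eq_integral ifg if2 ig2 ennreal_power ennreal_mult[symmetric]
        ennreal_le_iff integral_nonneg mult_nonneg_nonneg)
qed

lemma square_integrable_mult:
  assumes "square_integrable f" "square_integrable g"
  shows "integrable lborel (\<lambda>x. f x * g x)"
proof -
  have "(\<lambda>x. cnj (g x)) \<in> borel_measurable borel"
    using assms(2) by (intro borel_measurable_continuous_on[where f = cnj])
       (auto simp: square_integrable_def intro!: continuous_intros)
  then have "square_integrable (\<lambda>x. cnj (g x))"
    using assms(2) by (auto simp: square_integrable_def)
  from square_integrable_mult_cnj[OF assms(1) this] show ?thesis by simp
qed

lemma square_integrable_diff:
  "square_integrable f \<Longrightarrow> square_integrable g \<Longrightarrow> square_integrable (\<lambda>x. f x - g x)"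
  using square_integrable_add[of f "\<lambda>x. - 1 * g x"] square_integrable_cmult[of g "-1"] by simp

lemma norm_integral_mult_le:
  assumes f: "square_integrable f" and g: "square_integrable g"
  shows "cmod (\<integral>x. f x * g x \<partial>lborel) \<le>
           sqrt ((\<integral>x. (cmod (f x))\<^sup>2 \<partial>lborel) * (\<integral>x. (cmod (g x))\<^sup>2 \<partial>lborel))"
proof (rule real_le_rsqrt)
  have "cmod (\<integral>x. f x * g x \<partial>lborel) \<le> (\<integral>x. cmod (f x * g x) \<partial>lborel)"
    by (rule integral_norm_bound)
  then have "(cmod (\<integral>x. f x * g x \<partial>lborel))\<^sup>2 \<le> (\<integral>x. cmod (f x) * cmod (g x) \<partial>lborel)\<^sup>2"
    by (intro power_mono) (simp_all add: norm_mult)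
  also have "\<dots> \<le> (\<integral>x. (cmod (f x))\<^sup>2 \<partial>lborel) * (\<integral>x. (cmod (g x))\<^sup>2 \<partial>lborel)"
    by (rule cauchy_schwarz_square_integrable[OF f g])
  finally show "(cmod (\<integral>x. f x * g x \<partial>lborel))\<^sup>2 \<le> \<dots>" .
qed

section \<open>The Cauchy kernel and the Cauchy transform\<close>

definition cauchy_kernel :: "complex \<Rightarrow> real \<Rightarrow> complex" where
  "cauchy_kernel v x = 1 / (of_real x - v)"

lemma cnj_cauchy_kernel: "cnj (cauchy_kernel v x) = cauchy_kernel (cnj v) x"
  by (simp add: cauchy_kernel_def)

lemma cauchy_kernel_measurable [measurable]: "cauchy_kernel v \<in> borel_measurable borel"
  unfolding cauchy_kernel_def by measurable

lemma norm_cauchy_kernel_squared: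
  "(cmod (cauchy_kernel v x))\<^sup>2 = 1 / ((x - Re v)\<^sup>2 + (Im v)\<^sup>2)"
  by (simp add: cauchy_kernel_def norm_divide power_divide cmod_power2)

lemma cauchy_kernel_nonzero: "Im a \<noteq> 0 \<Longrightarrow> cauchy_kernel a x \<noteq> 0"
  by (auto simp: cauchy_kernel_def)

lemma cauchy_kernel_mult:
  assumes "of_real x \<noteq> a" "of_real x \<noteq> v"
  shows "cauchy_kernel a x - cauchy_kernel v x = (a - v) * (cauchy_kernel a x * cauchy_kernel v x)"
  using assms by (simp add: cauchy_kernel_def divide_simps)

lemma norm_cauchy_kernel_le:
  assumes "dist (of_real x) v \<ge> d" "d > 0"
  shows "cmod (cauchy_kernel v x) \<le> 1 / d"
  unfolding cauchy_kernel_def norm_divide using assms by (intro frac_le) (auto simp: dist_norm)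

lemma
  assumes "Im v \<noteq> 0"
  shows square_integrable_cauchy_kernel: "square_integrable (cauchy_kernel v)"
    and integral_norm_cauchy_kernel_squared:
      "(\<integral>x. (cmod (cauchy_kernel v x))\<^sup>2 \<partial>lborel) = (\<integral>x. inverse (1 + x\<^sup>2) \<partial>lborel) / \<bar>Im v\<bar>"
proof -
  define a b where "a = Re v" and "b = Im v"
  have b: "b \<noteq> 0" using assms by (simp add: b_def)
  have int: "integrable lborel (\<lambda>x::real. inverse (1 + x\<^sup>2))"
    using integrable_inverse_1_plus_square by (simp add: set_integrable_def)
  have eq: "(cmod (cauchy_kernel v x))\<^sup>2 = inverse (b\<^sup>2) * inverse (1 + (- a / b + 1 / b * x)\<^sup>2)" for x
  proof -
    have "- a / b + 1 / b * x = (x - a) / b" by (simp add: diff_divide_distrib)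
    then have "b\<^sup>2 * (1 + (- a / b + 1 / b * x)\<^sup>2) = (x - a)\<^sup>2 + b\<^sup>2"
      using b by (simp add: power_divide distrib_left)
    then show ?thesis
      unfolding norm_cauchy_kernel_squared
      by (metis a_def b_def inverse_eq_divide inverse_mult_distrib)
  qed
  have "integrable lborel (\<lambda>x. inverse (1 + (- a / b + 1 / b * x)\<^sup>2))"
    using lborel_integrable_real_affine[OF int, of "1 / b" "- a / b"] b by simp
  then show "square_integrable (cauchy_kernel v)"
    unfolding square_integrable_def eq by simp
  have "(\<integral>x. inverse (1 + x\<^sup>2) \<partial>lborel) = \<bar>1 / b\<bar> * (\<integral>x. inverse (1 + (- a / b + 1 / b * x)\<^sup>2) \<partial>lborel)"
    using lborel_integral_real_affine[of "1 / b" "\<lambda>x. inverse (1 + x\<^sup>2)" "- a / b"] b by simp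
  then have "(\<integral>x. inverse (1 + (- a / b + 1 / b * x)\<^sup>2) \<partial>lborel) = \<bar>b\<bar> * (\<integral>x. inverse (1 + x\<^sup>2) \<partial>lborel)"
    using b by simp
  then have "(\<integral>x. (cmod (cauchy_kernel v x))\<^sup>2 \<partial>lborel) = inverse (b\<^sup>2) * (\<bar>b\<bar> * (\<integral>x. inverse (1 + x\<^sup>2) \<partial>lborel))"
    unfolding eq by (simp only: integral_mult_right_zero)
  moreover have "inverse (b\<^sup>2) * (\<bar>b\<bar> * J) = J / \<bar>b\<bar>" for J :: real
    using b by (simp add: power2_eq_square abs_if divide_simps)
  ultimately show "(\<integral>x. (cmod (cauchy_kernel v x))\<^sup>2 \<partial>lborel) = (\<integral>x. inverse (1 + x\<^sup>2) \<partial>lborel) / \<bar>Im v\<bar>"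
    by (simp only: b_def)
qed

definition cauchy_transform :: "(real \<Rightarrow> complex) \<Rightarrow> complex \<Rightarrow> complex" where
  "cauchy_transform f v = (\<integral>x. f x * cauchy_kernel v x \<partial>lborel)"

section \<open>The Cauchy transform of a Hardy function in the lower half plane\<close>

lemma open_upper_half_plane: "open upper_half_plane"
  unfolding upper_half_plane_def by (rule open_halfspace_Im_gt)

lemma convex_upper_half_plane: "convex upper_half_plane"
  unfolding upper_half_plane_def by (rule convex_halfspace_Im_gt)

lemma upper_half_plane_primitive:
  assumes "G holomorphic_on upper_half_plane"
  obtains H where "\<And>z. Im z > 0 \<Longrightarrow> (H has_field_derivative G z) (at z)"
proof -
  obtain H where "\<And>z. z \<in> upper_half_plane \<Longrightarrow> (H has_field_derivative G z) (at z within upper_half_plane)"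
    using holomorphic_convex_primitive'[OF convex_upper_half_plane open_upper_half_plane assms] by blast
  then have "(H has_field_derivative G z) (at z)" if "Im z > 0" for z
    using that at_within_open[OF _ open_upper_half_plane, of z] by (force simp: upper_half_plane_def)
  then show ?thesis by (rule that)
qed

text \<open>A primitive turns every integral along a horizontal segment into a difference of two values. The contour arguments
below are carried out with primitives in this way, without paths.\<close>
lemma integral_horizontal_segment:
  assumes H: "\<And>z. Im z > 0 \<Longrightarrow> (H has_field_derivative G z) (at z)"
    and G: "G holomorphic_on upper_half_plane" and "y > 0" "a \<le> b"
  shows "(\<integral>x. indicator {a..b} x *\<^sub>R G (Complex x y) \<partial>lborel) = H (Complex b y) - H (Complex a y)"
proof (rule integral_FTC_Icc[OF \<open>a \<le> b\<close>])
  show "((\<lambda>x. H (Complex x y)) has_vector_derivative G (Complex x y)) (at x within {a..b})" for x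
  proof -
    have "((\<lambda>x. Complex x y) has_vector_derivative 1) (at x within {a..b})"
      unfolding Complex_eq by (auto intro!: derivative_eq_intros)
    from field_vector_diff_chain_within[OF this, of H "G (Complex x y)"] H[of "Complex x y"] \<open>y > 0\<close>
    show ?thesis by (simp add: o_def has_field_derivative_at_within)
  qed
  have "continuous_on {a..b} (\<lambda>x. Complex x y)"
    unfolding Complex_eq by (intro continuous_intros)
  moreover have "(\<lambda>x. Complex x y) ` {a..b} \<subseteq> upper_half_plane"
    using \<open>y > 0\<close> by (auto simp: upper_half_plane_def)
  ultimately show "continuous_on {a..b} (\<lambda>x. G (Complex x y))"
    by (rule continuous_on_compose2[OF holomorphic_on_imp_continuous_on[OF G]])
qed

lemma hardy_function_lines:
  assumes "hardy_function F"
  obtains C where "C \<ge> 0" "\<And>y. y > 0 \<Longrightarrow> square_integrable (\<lambda>x. F (Complex x y))"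
    "\<And>y. y > 0 \<Longrightarrow> (\<integral>x. (cmod (F (Complex x y)))\<^sup>2 \<partial>lborel) \<le> C"
proof -
  obtain C where hol: "F holomorphic_on upper_half_plane"
    and C: "\<And>y. y > 0 \<Longrightarrow> (\<integral>\<^sup>+x. ennreal ((cmod (F (Complex x y)))\<^sup>2) \<partial>lborel) \<le> ennreal C"
    using assms unfolding hardy_function_def by blast
  have sq: "square_integrable (\<lambda>x. F (Complex x y))" if "y > 0" for y
  proof -
    have "continuous_on UNIV (\<lambda>x. Complex x y)"
      unfolding Complex_eq by (intro continuous_intros)
    moreover have "range (\<lambda>x. Complex x y) \<subseteq> upper_half_plane"
      using that by (auto simp: upper_half_plane_def)
    ultimately have "continuous_on UNIV (\<lambda>x. F (Complex x y))"
      by (rule continuous_on_compose2[OF holomorphic_on_imp_continuous_on[OF hol]])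
    then have [measurable]: "(\<lambda>x. F (Complex x y)) \<in> borel_measurable borel"
      by (rule borel_measurable_continuous_onI)
    have "(\<integral>\<^sup>+x. ennreal ((cmod (F (Complex x y)))\<^sup>2) \<partial>lborel) < \<infinity>"
      using C[OF that] by (rule order_le_less_trans) simp
    then show ?thesis
      unfolding square_integrable_def by (auto intro: integrableI_nonneg)
  qed
  have "(\<integral>x. (cmod (F (Complex x y)))\<^sup>2 \<partial>lborel) \<le> max 0 C" if "y > 0" for y
  proof -
    have "ennreal (\<integral>x. (cmod (F (Complex x y)))\<^sup>2 \<partial>lborel) \<le> ennreal (max 0 C)"
      using C[OF that] sq[OF that]
      by (subst nn_integral_eq_integral[symmetric]) (auto simp: square_integrable_def ennreal_max_0)
    then show ?thesis by (simp add: ennreal_le_iff)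
  qed
  with sq show ?thesis by (intro that[of "max 0 C"]) auto
qed

lemma square_integrable_indicator_interval: "square_integrable (indicator {a..b::real})"
  unfolding square_integrable_def
proof
  have "(cmod (indicator {a..b} x))\<^sup>2 = indicator {a..b} x" for x
    by (auto split: split_indicator)
  then show "integrable lborel (\<lambda>x. (cmod (indicator {a..b} x))\<^sup>2)"
    by (simp add: emeasure_lborel_Icc_eq)
qed simp

text \<open>The mean value property is replaced by a one-dimensional argument. By the Cauchy-Schwarz inequality on a
horizontal segment, the differences \<open>H(z + h) - H(z)\<close> of a primitive are bounded for \<open>0 \<le> h \<le> 1\<close>; Cauchy's
estimate for the derivative then bounds \<open>F(z + h) - F(z)\<close> away from the real line. Since the square of \<open>\<bar>F\<bar>\<close> has a bounded integral over the
segment from \<open>z\<close> to \<open>z + 1\<close>, some \<open>F(z + h)\<close> is bounded, and therefore so is \<open>F(z)\<close>.\<close>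
lemma hardy_function_bounded:
  assumes "hardy_function F" "y > 0"
  obtains K where "\<And>z. Im z \<ge> y \<Longrightarrow> cmod (F z) \<le> K"
proof -
  obtain C where "C \<ge> 0" and sq: "\<And>y. y > 0 \<Longrightarrow> square_integrable (\<lambda>x. F (Complex x y))"
    and C: "\<And>y. y > 0 \<Longrightarrow> (\<integral>x. (cmod (F (Complex x y)))\<^sup>2 \<partial>lborel) \<le> C"
    using hardy_function_lines[OF assms(1)] by blast
  have hol: "F holomorphic_on upper_half_plane"
    using assms(1) by (simp add: hardy_function_def)
  obtain H where H: "\<And>z. Im z > 0 \<Longrightarrow> (H has_field_derivative F z) (at z)"
    using upper_half_plane_primitive[OF hol] by blast
  have ind: "(\<integral>x. (cmod (indicator {a..a+h} x))\<^sup>2 \<partial>lborel) = h" if "h \<ge> 0" for a h :: real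
  proof -
    have "(cmod (indicator {a..a+h} x))\<^sup>2 = indicator {a..a+h} x" for x
      by (auto split: split_indicator)
    then show ?thesis using that by simp
  qed
  \<comment> \<open>The bound is uniform in \<open>z\<close>, up to the real line.\<close>
  have diff_H: "cmod (H (z + of_real h) - H z) \<le> sqrt C" if "Im z > 0" "0 \<le> h" "h \<le> 1" for z h
  proof -
    define a t where "a = Re z" and "t = Im z"
    have z: "z = Complex a t" "t > 0" using that by (simp_all add: a_def t_def)
    have shift: "z + of_real h = Complex (a + h) t" by (simp add: complex_eq_iff z)
    have "H (z + of_real h) - H z =
        (\<integral>x. indicator {a..a + h} x *\<^sub>R F (Complex x t) \<partial>lborel)"
      using integral_horizontal_segment[OF H hol \<open>t > 0\<close>, of a "a + h"] \<open>h \<ge> 0\<close> 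
      by (simp add: shift z(1)[symmetric])
    also have "\<dots> = (\<integral>x. indicator {a..a + h} x * F (Complex x t) \<partial>lborel)"
      by (intro Bochner_Integration.integral_cong) (auto split: split_indicator)
    also have "cmod \<dots> \<le> sqrt (h * (\<integral>x. (cmod (F (Complex x t)))\<^sup>2 \<partial>lborel))"
      using norm_integral_mult_le[OF square_integrable_indicator_interval sq[OF \<open>t > 0\<close>], of a "a + h"]
      by (simp only: ind[OF \<open>h \<ge> 0\<close>])
    also have "\<dots> \<le> sqrt (1 * C)"
      using C[OF \<open>t > 0\<close>] \<open>h \<ge> 0\<close> \<open>h \<le> 1\<close> by (intro real_sqrt_le_mono mult_mono) auto
    finally show ?thesis by simp
  qed
  have diff_F: "cmod (F (z + of_real h) - F z) \<le> sqrt C / (y / 2)" if "Im z \<ge> y" "0 \<le> h" "h \<le> 1" for z h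
  proof -
    let ?g = "\<lambda>z. H (z + of_real h) - H z"
    have pos: "Im x > 0" if "x \<in> cball z (y / 2)" for x
      using that \<open>Im z \<ge> y\<close> \<open>y > 0\<close> abs_Im_le_cmod[of "z - x"] by (auto simp: dist_norm)
    have g: "(?g has_field_derivative (F (x + of_real h) - F x)) (at x)" if "Im x > 0" for x
    proof -
      have "((\<lambda>w. H (w + of_real h)) has_field_derivative F (x + of_real h) * 1) (at x)"
        using that by (intro DERIV_chain2[where f = H]) (auto intro!: H derivative_eq_intros)
      then show ?thesis using H[OF that] by (auto intro!: derivative_eq_intros)
    qed
    \<comment> \<open>The disc of radius \<open>y / 2\<close> stays inside the upper half plane.\<close>
    have "norm ((deriv ^^ 1) ?g z) \<le> fact 1 * sqrt C / (y / 2) ^ 1"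
    proof (rule Cauchy_inequality)
      show "?g holomorphic_on ball z (y / 2)"
        by (intro holomorphic_onI) (metis g pos ball_subset_cball field_differentiable_at_within
              field_differentiable_def subsetD)
      show "continuous_on (cball z (y / 2)) ?g"
        by (intro continuous_at_imp_continuous_on ballI) (metis DERIV_isCont g pos)
      show "cmod (?g x) \<le> sqrt C" if "cmod (z - x) = y / 2" for x
        using diff_H[OF pos] that \<open>0 \<le> h\<close> \<open>h \<le> 1\<close> by (simp add: dist_norm)
    qed (use \<open>y > 0\<close> in simp)
    then show ?thesis
      using DERIV_imp_deriv[OF g[of z]] \<open>Im z \<ge> y\<close> \<open>y > 0\<close> by simp
  qed
  have small: "\<exists>h. 0 \<le> h \<and> h \<le> 1 \<and> cmod (F (z + of_real h)) \<le> C + 1" if "Im z > 0" for z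
  proof (rule ccontr)
    assume contra: "\<not> ?thesis"
    define a t where "a = Re z" and "t = Im z"
    have z: "z = Complex a t" "t > 0" using that by (simp_all add: a_def t_def)
    have "(\<integral>x. (C + 1) * indicator {a..a+1} x \<partial>lborel) \<le> (\<integral>x. (cmod (F (Complex x t)))\<^sup>2 \<partial>lborel)"
    proof (rule integral_mono)
      show "(C + 1) * indicator {a..a+1} x \<le> (cmod (F (Complex x t)))\<^sup>2" for x
      proof (cases "x \<in> {a..a+1}")
        case True
        have "z + of_real (x - a) = Complex x t" by (simp add: complex_eq_iff z)
        moreover have "0 \<le> x - a" "x - a \<le> 1" using True by auto
        ultimately have "cmod (F (Complex x t)) > C + 1"
          using contra by (metis not_le)
        then have "(C + 1) * 1 \<le> cmod (F (Complex x t)) * cmod (F (Complex x t))"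
          using \<open>C \<ge> 0\<close> by (intro mult_mono) auto
        with True show ?thesis by (simp add: power2_eq_square)
      qed simp
    qed (use sq[OF \<open>t > 0\<close>] in \<open>auto simp: square_integrable_def\<close>)
    with C[OF \<open>t > 0\<close>] show False by simp
  qed
  have "cmod (F z) \<le> C + 1 + sqrt C / (y / 2)" if "Im z \<ge> y" for z
  proof -
    obtain h where h: "0 \<le> h" "h \<le> 1" "cmod (F (z + of_real h)) \<le> C + 1"
      using small[of z] \<open>Im z \<ge> y\<close> \<open>y > 0\<close> by auto
    have "cmod (F z) \<le> cmod (F (z + of_real h)) + cmod (F (z + of_real h) - F z)"
      by (metis norm_minus_commute norm_triangle_sub)
    with diff_F[OF that h(1,2)] h(3) show ?thesis by linarith
  qed
  then show ?thesis by (rule that)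
qed

text \<open>Cauchy's theorem for a rectangle of height \<open>Y - y\<close> whose vertical sides recede to infinity: \<open>F\<close> is bounded there while
the kernel decays, so the sides contribute nothing in the limit. The shift by \<open>\<i> y\<close> appears because the kernel of
the fixed point \<open>v\<close>, evaluated on the line of height \<open>y\<close>, is the kernel of \<open>v - \<i> y\<close> on the real line.\<close>
lemma hardy_cauchy_line_constant:
  assumes F: "hardy_function F" and v: "Im v \<le> 0" and y: "0 < y" "y < Y"
  shows "(\<integral>x. F (Complex x y) * cauchy_kernel (v - \<i> * y) x \<partial>lborel) =
         (\<integral>x. F (Complex x Y) * cauchy_kernel (v - \<i> * Y) x \<partial>lborel)"
proof -
  define G where "G z = F z / (z - v)" for z
  have hol: "F holomorphic_on upper_half_plane"
    using F by (simp add: hardy_function_def)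
  have G: "G holomorphic_on upper_half_plane"
    unfolding G_def using v by (intro holomorphic_intros hol) (auto simp: upper_half_plane_def)
  obtain H where H: "\<And>z. Im z > 0 \<Longrightarrow> (H has_field_derivative G z) (at z)"
    using upper_half_plane_primitive[OF G] by blast
  obtain K where K: "\<And>z. Im z \<ge> y \<Longrightarrow> cmod (F z) \<le> K"
    using hardy_function_bounded[OF F \<open>0 < y\<close>] by blast
  have sq: "\<And>t. t > 0 \<Longrightarrow> square_integrable (\<lambda>x. F (Complex x t))"
    using hardy_function_lines[OF F] by metis
  have G_line: "G (Complex x t) = F (Complex x t) * cauchy_kernel (v - \<i> * t) x" for x t
    by (simp add: G_def cauchy_kernel_def Complex_eq algebra_simps)
  define I where "I n t = H (Complex n t) - H (Complex (- n) t)" for n t :: real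
  have I_lim: "(\<lambda>n. I (real n) t) \<longlonglongrightarrow> (\<integral>x. G (Complex x t) \<partial>lborel)" if "t > 0" for t
  proof -
    have int: "integrable lborel (\<lambda>x. G (Complex x t))"
      unfolding G_line using v that
      by (intro square_integrable_mult sq square_integrable_cauchy_kernel) auto
    have "(\<lambda>n. \<integral>x. indicator {- real n..real n} x *\<^sub>R G (Complex x t) \<partial>lborel)
        \<longlonglongrightarrow> (\<integral>x. G (Complex x t) \<partial>lborel)"
    proof (rule integral_dominated_convergence)
      show "integrable lborel (\<lambda>x. cmod (G (Complex x t)))" using int by simp
      show "AE x in lborel. (\<lambda>n. indicator {- real n..real n} x *\<^sub>R G (Complex x t)) \<longlonglongrightarrow> G (Complex x t)"
      proof (intro AE_I2 tendsto_eventually)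
        fix x :: real
        have "indicator {- real n..real n} x *\<^sub>R G (Complex x t) = G (Complex x t)"
          if "n \<ge> nat \<lceil>\<bar>x\<bar>\<rceil>" for n
        proof -
          have "\<bar>x\<bar> \<le> real n" using that by linarith
          then show ?thesis by (auto simp: indicator_def abs_le_iff)
        qed
        then show "\<forall>\<^sub>F n in sequentially. indicator {- real n..real n} x *\<^sub>R G (Complex x t) = G (Complex x t)"
          by (rule eventually_sequentiallyI)
      qed
    qed (use int in \<open>auto split: split_indicator\<close>)
    then show ?thesis
      by (simp add: integral_horizontal_segment[OF H G that] I_def)
  qed
  have side: "cmod (H (Complex s y) - H (Complex s Y)) \<le> K / (real n - \<bar>Re v\<bar>) * (Y - y)"
    if n: "real n > \<bar>Re v\<bar>" and s: "\<bar>s\<bar> = real n" for s n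
  proof -
    define S where "S = {z. Re z = s \<and> y \<le> Im z}"
    have "convex S"
    proof -
      have "S = {z. Re z \<ge> s} \<inter> {z. Re z \<le> s} \<inter> {z. Im z \<ge> y}" by (auto simp: S_def)
      then show ?thesis by (auto intro!: convex_Int convex_halfspace_Im_ge convex_halfspace_Re_ge
          convex_halfspace_Re_le)
    qed
    have "cmod (H (Complex s y) - H (Complex s Y)) \<le>
        K / (real n - \<bar>Re v\<bar>) * cmod (Complex s y - Complex s Y)"
    proof (rule field_differentiable_bound[OF \<open>convex S\<close>])
      fix z assume z: "z \<in> S"
      show "(H has_field_derivative G z) (at z within S)"
        by (rule has_field_derivative_at_within[OF H]) (use z \<open>0 < y\<close> in \<open>auto simp: S_def\<close>)
      have "real n - \<bar>Re v\<bar> \<le> \<bar>s - Re v\<bar>" using s by linarith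
      also have "\<dots> \<le> cmod (z - v)" using z abs_Re_le_cmod[of "z - v"] by (simp add: S_def)
      finally show "cmod (G z) \<le> K / (real n - \<bar>Re v\<bar>)"
        unfolding G_def norm_divide using n K[of z] z order_trans[OF norm_ge_zero K, of z]
        by (intro frac_le) (auto simp: S_def)
    qed (use y in \<open>auto simp: S_def\<close>)
    moreover have "cmod (Complex s y - Complex s Y) = Y - y"
      using y by (simp add: cmod_def)
    ultimately show ?thesis by simp
  qed
  have "(\<lambda>n. I (real n) y - I (real n) Y) \<longlonglongrightarrow> 0"
  proof (rule Lim_null_comparison)
    show "\<forall>\<^sub>F n in sequentially. norm (I (real n) y - I (real n) Y) \<le> 2 * (K / (real n - \<bar>Re v\<bar>) * (Y - y))"
    proof (rule eventually_mono[OF filterlim_at_top_dense[THEN iffD1, OF filterlim_real_sequentially, rule_format]])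
      fix n assume n: "\<bar>Re v\<bar> < real n"
      have "I (real n) y - I (real n) Y =
          (H (Complex n y) - H (Complex n Y)) - (H (Complex (- n) y) - H (Complex (- n) Y))"
        by (simp add: I_def)
      also have "norm \<dots> \<le> cmod (H (Complex n y) - H (Complex n Y)) + cmod (H (Complex (- n) y) - H (Complex (- n) Y))"
        by (rule norm_triangle_ineq4)
      finally show "norm (I (real n) y - I (real n) Y) \<le> 2 * (K / (real n - \<bar>Re v\<bar>) * (Y - y))"
        using side[OF n, of "real n"] side[OF n, of "- real n"] by simp
    qed
    show "(\<lambda>n. 2 * (K / (real n - \<bar>Re v\<bar>) * (Y - y))) \<longlonglongrightarrow> 0" by real_asymp
  qed
  moreover have "(\<lambda>n. I (real n) y - I (real n) Y) \<longlonglongrightarrow>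
      (\<integral>x. G (Complex x y) \<partial>lborel) - (\<integral>x. G (Complex x Y) \<partial>lborel)"
    using y by (intro tendsto_diff I_lim) auto
  ultimately have "(\<integral>x. G (Complex x y) \<partial>lborel) - (\<integral>x. G (Complex x Y) \<partial>lborel) = 0"
    using LIMSEQ_unique by blast
  then show ?thesis unfolding G_line by simp
qed

text \<open>The common value on all lines is zero: as the height \<open>t\<close> grows, the squared norm of the kernel decreases like \<open>1/t\<close>
while that of \<open>F\<close> stays bounded.\<close>
lemma hardy_cauchy_line_zero:
  assumes F: "hardy_function F" and v: "Im v \<le> 0" and y: "0 < y"
  shows "(\<integral>x. F (Complex x y) * cauchy_kernel (v - \<i> * y) x \<partial>lborel) = 0"
proof -
  define I where "I t = (\<integral>x. F (Complex x t) * cauchy_kernel (v - \<i> * t) x \<partial>lborel)" for t :: real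
  define J where "J = (\<integral>x. inverse (1 + x\<^sup>2) \<partial>(lborel :: real measure))"
  obtain C where "C \<ge> 0" and sq: "\<And>y. y > 0 \<Longrightarrow> square_integrable (\<lambda>x. F (Complex x y))"
    and C: "\<And>y. y > 0 \<Longrightarrow> (\<integral>x. (cmod (F (Complex x y)))\<^sup>2 \<partial>lborel) \<le> C"
    using hardy_function_lines[OF F] by blast
  have "J \<ge> 0" unfolding J_def by (intro integral_nonneg_AE AE_I2) auto
  have "(I \<longlongrightarrow> 0) at_top"
  proof (rule Lim_null_comparison)
    show "\<forall>\<^sub>F t in at_top. norm (I t) \<le> sqrt (C * (J / (t - Im v)))"
    proof (rule eventually_mono[OF eventually_gt_at_top[of 0]])
      fix t :: real assume t: "0 < t"
      then have im: "Im (v - \<i> * t) \<noteq> 0" "\<bar>Im (v - \<i> * t)\<bar> = t - Im v" using v by auto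
      have "norm (I t) \<le> sqrt ((\<integral>x. (cmod (F (Complex x t)))\<^sup>2 \<partial>lborel) * (J / (t - Im v)))"
        unfolding I_def J_def im(2)[symmetric] integral_norm_cauchy_kernel_squared[OF im(1), symmetric]
        by (rule norm_integral_mult_le[OF sq[OF t] square_integrable_cauchy_kernel[OF im(1)]])
      also have "\<dots> \<le> sqrt (C * (J / (t - Im v)))"
        using C[OF t] t v \<open>J \<ge> 0\<close> by (intro real_sqrt_le_mono mult_right_mono) auto
      finally show "norm (I t) \<le> sqrt (C * (J / (t - Im v)))" .
    qed
    have "((\<lambda>t. C * (J / (t - Im v))) \<longlongrightarrow> 0) at_top" by real_asymp
    from tendsto_real_sqrt[OF this]
    show "((\<lambda>t. sqrt (C * (J / (t - Im v)))) \<longlongrightarrow> 0) at_top" by simp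
  qed
  moreover have "\<forall>\<^sub>F t in at_top. I t = I y"
    using hardy_cauchy_line_constant[OF F v y] unfolding I_def
    by (intro eventually_mono[OF eventually_gt_at_top[of y]]) simp
  then have "(I \<longlongrightarrow> I y) at_top" by (rule tendsto_eventually)
  ultimately have "I y = 0" by (rule tendsto_unique[OF trivial_limit_at_top_linorder, rotated])
  then show ?thesis by (simp add: I_def)
qed

text \<open>Passage to the boundary. Both the Hardy function and the kernel converge in square mean on the lines of height \<open>y\<close>
as \<open>y\<close> decreases to \<open>0\<close>.\<close>
lemma cauchy_transform_boundary_value_zero:
  assumes F: "hardy_function F" and f: "square_integrable f" and v: "Im v < 0"
    and lim: "((\<lambda>y. \<integral>\<^sup>+x. ennreal ((cmod (F (Complex x y) - f x))\<^sup>2) \<partial>lborel) \<longlongrightarrow> 0) (at_right 0)"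
  shows "cauchy_transform f v = 0"
proof -
  define J where "J = (\<integral>x. inverse (1 + x\<^sup>2) \<partial>(lborel :: real measure)) / \<bar>Im v\<bar>"
  define e where "e y = (\<integral>x. (cmod (F (Complex x y) - f x))\<^sup>2 \<partial>lborel)" for y
  define B where "B = (\<integral>x. cmod (f x) * cmod (cauchy_kernel v x) \<partial>lborel)"
  have kv: "square_integrable (cauchy_kernel v)"
    using v by (intro square_integrable_cauchy_kernel) auto
  have sq: "\<And>y. y > 0 \<Longrightarrow> square_integrable (\<lambda>x. F (Complex x y))"
    using hardy_function_lines[OF F] by metis
  have sqd: "square_integrable (\<lambda>x. F (Complex x y) - f x)" if "y > 0" for y
    by (intro square_integrable_diff sq that f)
  have "\<forall>\<^sub>F y in at_right 0. enn2real (\<integral>\<^sup>+x. ennreal ((cmod (F (Complex x y) - f x))\<^sup>2) \<partial>lborel) = e y"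
    unfolding e_def
    using sqd by (intro eventually_mono[OF eventually_at_right_less[of 0]])
       (simp add: nn_integral_eq_integral square_integrable_def)
  moreover have "((\<lambda>y. enn2real (\<integral>\<^sup>+x. ennreal ((cmod (F (Complex x y) - f x))\<^sup>2) \<partial>lborel)) \<longlongrightarrow> 0) (at_right 0)"
    by (rule tendsto_enn2real) (use lim in simp_all)
  ultimately have e_lim: "(e \<longlongrightarrow> 0) (at_right 0)"
    by (rule Lim_transform_eventually[rotated])
  have bound: "cmod (cauchy_transform f v) \<le> sqrt (e y * J) + y / \<bar>Im v\<bar> * B" if y: "y > 0" for y
  proof -
    let ?u = "v - \<i> * y"
    have ku: "square_integrable (cauchy_kernel ?u)"
      using v y by (intro square_integrable_cauchy_kernel) auto
    have kdiff: "cauchy_kernel ?u x - cauchy_kernel v x = - (\<i> * y) * (cauchy_kernel ?u x * cauchy_kernel v x)" for x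
    proof -
      have "of_real x \<noteq> ?u" "of_real x \<noteq> v" using v y by (auto simp: complex_eq_iff)
      from cauchy_kernel_mult[OF this] show ?thesis by simp
    qed
    have k_le: "cmod (cauchy_kernel ?u x) \<le> 1 / \<bar>Im v\<bar>" for x
      using abs_Im_le_cmod[of "of_real x - ?u"] v y
      by (auto simp: cauchy_kernel_def norm_divide divide_simps)
    have solve: "c = - (a + b)" if "0 = a + (b + c)" for a b c :: complex
      using that by (metis add.assoc minus_unique)
    note i1 = square_integrable_mult[OF sqd[OF y] ku]
      and i2 = square_integrable_mult[OF f square_integrable_diff[OF ku kv]]
      and i3 = square_integrable_mult[OF f kv]
    have "0 = (\<integral>x. F (Complex x y) * cauchy_kernel ?u x \<partial>lborel)"
      using hardy_cauchy_line_zero[OF F _ y, of v] v by simp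
    also have "\<dots> = (\<integral>x. (F (Complex x y) - f x) * cauchy_kernel ?u x +
        (f x * (cauchy_kernel ?u x - cauchy_kernel v x) + f x * cauchy_kernel v x) \<partial>lborel)"
      by (simp add: algebra_simps)
    also have "\<dots> = (\<integral>x. (F (Complex x y) - f x) * cauchy_kernel ?u x \<partial>lborel) +
        ((\<integral>x. f x * (cauchy_kernel ?u x - cauchy_kernel v x) \<partial>lborel) + cauchy_transform f v)"
      unfolding cauchy_transform_def
      by (simp only: Bochner_Integration.integral_add[OF i1 Bochner_Integration.integrable_add[OF i2 i3]]
          Bochner_Integration.integral_add[OF i2 i3])
    finally have "cauchy_transform f v = - ((\<integral>x. (F (Complex x y) - f x) * cauchy_kernel ?u x \<partial>lborel) +
        (\<integral>x. f x * (cauchy_kernel ?u x - cauchy_kernel v x) \<partial>lborel))"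
      by (rule solve)
    then have "cmod (cauchy_transform f v) \<le>
        cmod (\<integral>x. (F (Complex x y) - f x) * cauchy_kernel ?u x \<partial>lborel) +
        cmod (\<integral>x. f x * (cauchy_kernel ?u x - cauchy_kernel v x) \<partial>lborel)"
      by (simp only: norm_minus_cancel norm_triangle_ineq)
    moreover have "cmod (\<integral>x. (F (Complex x y) - f x) * cauchy_kernel ?u x \<partial>lborel) \<le> sqrt (e y * J)"
    proof -
      have "(\<integral>x. (cmod (cauchy_kernel ?u x))\<^sup>2 \<partial>lborel) \<le> J"
      proof -
        have "Im ?u \<noteq> 0" "\<bar>Im v\<bar> \<le> \<bar>Im ?u\<bar>" using v y by auto
        moreover have "0 \<le> (\<integral>x. inverse (1 + x\<^sup>2) \<partial>(lborel :: real measure))"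
          by (rule integral_nonneg_AE) simp
        ultimately show ?thesis
          unfolding J_def integral_norm_cauchy_kernel_squared[OF \<open>Im ?u \<noteq> 0\<close>]
          using v y by (intro divide_left_mono mult_pos_pos) auto
      qed
      then have "sqrt (e y * (\<integral>x. (cmod (cauchy_kernel ?u x))\<^sup>2 \<partial>lborel)) \<le> sqrt (e y * J)"
        by (intro real_sqrt_le_mono mult_left_mono) (auto simp: e_def)
      with norm_integral_mult_le[OF sqd[OF y] ku] show ?thesis
        unfolding e_def by linarith
    qed
    moreover have "cmod (\<integral>x. f x * (cauchy_kernel ?u x - cauchy_kernel v x) \<partial>lborel) \<le> y / \<bar>Im v\<bar> * B"
    proof -
      have "cmod (\<integral>x. f x * (cauchy_kernel ?u x - cauchy_kernel v x) \<partial>lborel) \<le>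
          (\<integral>x. y / \<bar>Im v\<bar> * (cmod (f x) * cmod (cauchy_kernel v x)) \<partial>lborel)"
      proof (rule Bochner_Integration.integral_norm_bound_integral)
        show "integrable lborel (\<lambda>x. f x * (cauchy_kernel ?u x - cauchy_kernel v x))"
          by (intro square_integrable_mult square_integrable_diff f ku kv)
        show "integrable lborel (\<lambda>x. y / \<bar>Im v\<bar> * (cmod (f x) * cmod (cauchy_kernel v x)))"
          using integrable_norm[OF square_integrable_mult[OF f kv]]
          by (intro integrable_mult_right) (simp add: norm_mult)
        show "cmod (f x * (cauchy_kernel ?u x - cauchy_kernel v x)) \<le>
            y / \<bar>Im v\<bar> * (cmod (f x) * cmod (cauchy_kernel v x))" for x
        proof -
          have "cmod (f x * (cauchy_kernel ?u x - cauchy_kernel v x)) =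
              (y * cmod (cauchy_kernel ?u x)) * (cmod (f x) * cmod (cauchy_kernel v x))"
            unfolding kdiff using y by (simp add: norm_mult)
          also have "\<dots> \<le> (y * (1 / \<bar>Im v\<bar>)) * (cmod (f x) * cmod (cauchy_kernel v x))"
            using y by (intro mult_right_mono mult_left_mono k_le) auto
          finally show ?thesis by simp
        qed
      qed
      then show ?thesis unfolding B_def by simp
    qed
    ultimately show ?thesis by linarith
  qed
  have "((\<lambda>y. sqrt (e y * J) + y / \<bar>Im v\<bar> * B) \<longlongrightarrow> sqrt (0 * J) + 0 / \<bar>Im v\<bar> * B) (at_right 0)"
    using v by (intro tendsto_intros e_lim) auto
  then have "cmod (cauchy_transform f v) \<le> sqrt (0 * J) + 0 / \<bar>Im v\<bar> * B"
    by (rule tendsto_lowerbound)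
       (use bound in \<open>auto intro: eventually_mono[OF eventually_at_right_less]\<close>)
  then show ?thesis by simp
qed

section \<open>Injectivity of the Cauchy transform\<close>

text \<open>The rays \<open>{t<..}\<close> determine a finite Borel measure, so the positive and the negative part of \<open>h\<close> are densities of
the same measure.\<close>
lemma AE_zero_if_ray_integrals_zero_real:
  fixes h :: "real \<Rightarrow> real"
  assumes h: "integrable lborel h" and zero: "\<And>t. (\<integral>x. indicator {t<..} x * h x \<partial>lborel) = 0"
  shows "AE x in lborel. h x = 0"
proof -
  have [measurable]: "h \<in> borel_measurable borel" using h by auto
  let ?p = "\<lambda>x. max 0 (h x)" and ?n = "\<lambda>x. max 0 (- h x)"
  have ip: "integrable lborel ?p" and im: "integrable lborel ?n" using h by auto
  have ray: "emeasure (density lborel (\<lambda>x. ennreal (g x))) {t<..} = ennreal (\<integral>x. indicator {t<..} x * g x \<partial>lborel)"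
    if "integrable lborel g" "\<And>x. g x \<ge> 0" for g :: "real \<Rightarrow> real" and t
  proof -
    have [measurable]: "g \<in> borel_measurable borel" using that by auto
    have "emeasure (density lborel (\<lambda>x. ennreal (g x))) {t<..} = (\<integral>\<^sup>+x. ennreal (indicator {t<..} x * g x) \<partial>lborel)"
      by (subst emeasure_density) (auto intro!: nn_integral_cong split: split_indicator)
    also have "\<dots> = ennreal (\<integral>x. indicator {t<..} x * g x \<partial>lborel)"
      using that integrable_mult_indicator[of "{t<..}" lborel g]
      by (intro nn_integral_eq_integral) auto
    finally show ?thesis .
  qed
  have "density lborel (\<lambda>x. ennreal (?p x)) = density lborel (\<lambda>x. ennreal (?n x))"
  proof (rule measure_eqI_lessThan)
    fix t :: real
    have ip': "integrable lborel (\<lambda>x. indicator {t<..} x * ?p x)"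
      using integrable_mult_indicator[OF _ ip, of "{t<..}"] by simp
    have im': "integrable lborel (\<lambda>x. indicator {t<..} x * ?n x)"
      using integrable_mult_indicator[OF _ im, of "{t<..}"] by simp
    have "(\<integral>x. indicator {t<..} x * ?p x \<partial>lborel) - (\<integral>x. indicator {t<..} x * ?n x \<partial>lborel) =
        (\<integral>x. indicator {t<..} x * h x \<partial>lborel)"
      by (subst Bochner_Integration.integral_diff[OF ip' im', symmetric])
         (auto intro!: Bochner_Integration.integral_cong simp: max_def)
    with zero show "emeasure (density lborel (\<lambda>x. ennreal (?p x))) {t<..} =
        emeasure (density lborel (\<lambda>x. ennreal (?n x))) {t<..}"
      by (simp add: ray ip im)
    show "emeasure (density lborel (\<lambda>x. ennreal (?p x))) {t<..} < \<infinity>"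
      by (simp add: ray ip)
  qed simp_all
  then have "AE x in lborel. ennreal (?p x) = ennreal (?n x)"
    by (intro sigma_finite_measure.density_unique[OF lborel.sigma_finite_measure_axioms]) auto
  then show ?thesis
    by (elim eventually_mono) (auto simp: max_def split: if_splits)
qed

lemma AE_zero_if_ray_integrals_zero:
  fixes h :: "real \<Rightarrow> complex"
  assumes h: "integrable lborel h" and zero: "\<And>t. (\<integral>x. indicator {t<..} x * h x \<partial>lborel) = 0"
  shows "AE x in lborel. h x = 0"
proof -
  have int: "integrable lborel (\<lambda>x. indicator {t<..} x * h x)" for t
  proof -
    have "(\<lambda>x. indicator {t<..} x * h x) = (\<lambda>x. indicator {t<..} x *\<^sub>R h x)"
      by (auto split: split_indicator)
    then show ?thesis using integrable_mult_indicator[OF _ h, of "{t<..}"] by simp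
  qed
  have "(\<integral>x. indicator {t<..} x * Re (h x) \<partial>lborel) = Re (\<integral>x. indicator {t<..} x * h x \<partial>lborel)" for t
    by (subst integral_Re[OF int, symmetric])
       (auto intro!: Bochner_Integration.integral_cong split: split_indicator)
  then have re: "AE x in lborel. Re (h x) = 0"
    by (intro AE_zero_if_ray_integrals_zero_real) (use h zero in auto)
  have "(\<integral>x. indicator {t<..} x * Im (h x) \<partial>lborel) = Im (\<integral>x. indicator {t<..} x * h x \<partial>lborel)" for t
    by (subst integral_Im[OF int, symmetric])
       (auto intro!: Bochner_Integration.integral_cong split: split_indicator)
  then have im: "AE x in lborel. Im (h x) = 0"
    by (intro AE_zero_if_ray_integrals_zero_real) (use h zero in auto)
  from re im show ?thesis by eventually_elim (simp add: complex_eq_iff)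
qed

text \<open>The Poisson kernel (up to a factor \<open>\<pi>\<close>), integrated over a ray of boundary points. As \<open>y\<close> decreases to \<open>0\<close> the value
tends to \<open>\<pi>\<close> for \<open>x > t\<close> and to \<open>0\<close> for \<open>x < t\<close>.\<close>
lemma poisson_ray:
  fixes y :: real
  assumes y: "y > 0"
  shows "has_bochner_integral lborel (\<lambda>u. indicator {t..} u * (y / ((x - u)\<^sup>2 + y\<^sup>2))) (pi / 2 - arctan ((t - x) / y))"
proof (rule has_bochner_integral_nn_integral)
  have [simp]: "(x - u)\<^sup>2 + y\<^sup>2 \<noteq> 0" for u using y by (simp add: add_nonneg_eq_0_iff)
  have "(\<integral>\<^sup>+u. ennreal (y / ((x - u)\<^sup>2 + y\<^sup>2)) * indicator {t..} u \<partial>lborel) = ennreal (pi / 2 - arctan ((t - x) / y))"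
  proof (rule nn_integral_FTC_atLeast)
    show "((\<lambda>u. arctan ((u - x) / y)) has_real_derivative y / ((x - u)\<^sup>2 + y\<^sup>2)) (at u)" for u
    proof -
      have "1 + ((u - x) / y)\<^sup>2 = ((x - u)\<^sup>2 + y\<^sup>2) / y\<^sup>2"
        using y by (simp add: power_divide divide_simps power2_commute)
      then have "inverse (1 + ((u - x) / y)\<^sup>2) / y = y / ((x - u)\<^sup>2 + y\<^sup>2)"
        using y by (simp add: power2_eq_square)
      moreover have "((\<lambda>u. arctan ((u - x) / y)) has_real_derivative inverse (1 + ((u - x) / y)\<^sup>2) / y) (at u)"
        using y by (auto intro!: derivative_eq_intros simp: divide_simps)
      ultimately show ?thesis by simp
    qed
    have "filterlim (\<lambda>u. (u - x) / y) at_top at_top" using y by real_asymp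
    from filterlim_compose[OF tendsto_arctan_at_top this]
    show "((\<lambda>u. arctan ((u - x) / y)) \<longlongrightarrow> pi / 2) at_top" .
  qed (use y in auto)
  then show "(\<integral>\<^sup>+u. ennreal (indicator {t..} u * (y / ((x - u)\<^sup>2 + y\<^sup>2))) \<partial>lborel) = ennreal (pi / 2 - arctan ((t - x) / y))"
    by (subst (asm) nn_integral_cong[where v = "\<lambda>u. ennreal (indicator {t..} u * (y / ((x - u)\<^sup>2 + y\<^sup>2)))"])
       (auto split: split_indicator)
  show "0 \<le> pi / 2 - arctan ((t - x) / y)"
    using arctan_ubound[of "(t - x) / y"] by simp
qed (use y in auto)

text \<open>The difference of the Cauchy transforms at \<open>u + \<i> y\<close> and \<open>u - \<i> y\<close> is \<open>2 \<i>\<close> times the Poisson integral of \<open>f\<close>. Integrating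
it over \<open>u \<ge> t\<close> and letting \<open>y\<close> decrease to \<open>0\<close> recovers \<open>\<pi>\<close> times the integral of \<open>f\<close> over the ray beyond \<open>t\<close>. Only small
\<open>y\<close> enter, which leaves room in the hypothesis to exclude points far from the real line.\<close>
lemma cauchy_transform_injective_integrable:
  assumes f: "integrable lborel f"
    and zero: "\<And>v. Im v \<noteq> 0 \<Longrightarrow> \<bar>Im v\<bar> < 1 \<Longrightarrow> cauchy_transform f v = 0"
  shows "AE x in lborel. f x = 0"
proof (rule AE_zero_if_ray_integrals_zero[OF f])
  fix t :: real
  have [measurable]: "f \<in> borel_measurable borel" using f by auto
  have P: "(\<integral>x. f x * of_real (y / ((x - u)\<^sup>2 + y\<^sup>2)) \<partial>lborel) = 0" if y: "0 < y" "y < 1" for y u :: real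
  proof -
    have int: "integrable lborel (\<lambda>x. f x * cauchy_kernel v x)" if "Im v \<noteq> 0" for v
    proof (rule Bochner_Integration.integrable_bound)
      show "integrable lborel (\<lambda>x. (1 / \<bar>Im v\<bar>) * cmod (f x))" using f by simp
      have "cmod (cauchy_kernel v x) \<le> 1 / \<bar>Im v\<bar>" for x
        using abs_Im_le_cmod[of "of_real x - v"] that
        by (auto simp: cauchy_kernel_def norm_divide intro!: frac_le)
      then show "AE x in lborel. norm (f x * cauchy_kernel v x) \<le> norm ((1 / \<bar>Im v\<bar>) * cmod (f x))"
        using mult_left_mono[OF _ norm_ge_zero, of "cmod (cauchy_kernel v _)" "1 / \<bar>Im v\<bar>"]
        by (intro AE_I2) (simp add: norm_mult mult.commute)
    qed measurable
    have eq: "f x * cauchy_kernel (Complex u y) x - f x * cauchy_kernel (Complex u (- y)) x =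
        2 * \<i> * (f x * of_real (y / ((x - u)\<^sup>2 + y\<^sup>2)))" for x
    proof -
      have ne: "of_real x \<noteq> Complex u y" "of_real x \<noteq> Complex u (- y)" using y by (auto simp: complex_eq_iff)
      have "(of_real x - Complex u y) * (of_real x - Complex u (- y)) = of_real ((x - u)\<^sup>2 + y\<^sup>2)"
        by (simp add: complex_eq_iff power2_eq_square algebra_simps)
      moreover have "cauchy_kernel (Complex u y) x - cauchy_kernel (Complex u (- y)) x =
          (Complex u y - Complex u (- y)) / ((of_real x - Complex u y) * (of_real x - Complex u (- y)))"
        using ne by (simp add: cauchy_kernel_def divide_simps)
      moreover have "Complex u y - Complex u (- y) = 2 * \<i> * y" by (simp add: complex_eq_iff)
      ultimately have "cauchy_kernel (Complex u y) x - cauchy_kernel (Complex u (- y)) x =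
          2 * \<i> * of_real (y / ((x - u)\<^sup>2 + y\<^sup>2))" by simp
      then show ?thesis by (simp add: right_diff_distrib[symmetric])
    qed
    have "2 * \<i> * (\<integral>x. f x * of_real (y / ((x - u)\<^sup>2 + y\<^sup>2)) \<partial>lborel) =
        cauchy_transform f (Complex u y) - cauchy_transform f (Complex u (- y))"
      unfolding cauchy_transform_def integral_mult_right_zero[symmetric] eq[symmetric]
      by (rule Bochner_Integration.integral_diff) (use y int in simp_all)
    also have "\<dots> = 0" using zero[of "Complex u y"] zero[of "Complex u (- y)"] y by simp
    finally show ?thesis by simp
  qed
  have T: "(\<integral>x. f x * of_real (pi / 2 - arctan ((t - x) / y)) \<partial>lborel) = 0" if y: "0 < y" "y < 1" for y :: real
  proof -
    let ?g = "\<lambda>x u. f x * of_real (indicator {t..} u * (y / ((x - u)\<^sup>2 + y\<^sup>2)))"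
    note P1 = poisson_ray[OF \<open>0 < y\<close>, of t]
    have norm_g: "norm (?g x u) = norm (f x) * (indicator {t..} u * (y / ((x - u)\<^sup>2 + y\<^sup>2)))" for x u
      unfolding norm_mult norm_of_real using y by (auto split: split_indicator)
    have "integrable (lborel \<Otimes>\<^sub>M lborel) (case_prod ?g)"
    proof (rule lborel_pair.Fubini_integrable)
      show "(\<lambda>(x, u). ?g x u) \<in> borel_measurable (lborel \<Otimes>\<^sub>M lborel)" by measurable
      have "(\<integral>u. norm (?g x u) \<partial>lborel) = norm (f x) * (pi / 2 - arctan ((t - x) / y))" for x
        unfolding norm_g by (simp only: integral_mult_right_zero has_bochner_integral_integral_eq[OF P1])
      moreover have "integrable lborel (\<lambda>x. norm (f x) * (pi / 2 - arctan ((t - x) / y)))"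
      proof (rule Bochner_Integration.integrable_bound)
        show "integrable lborel (\<lambda>x. pi * norm (f x))" using f by simp
        have "\<bar>pi / 2 - arctan s\<bar> \<le> pi" for s using arctan_ubound[of s] arctan_lbound[of s] by linarith
        then show "AE x in lborel. norm (norm (f x) * (pi / 2 - arctan ((t - x) / y))) \<le> norm (pi * norm (f x))"
          by (intro AE_I2) (simp add: abs_mult mult.commute[of pi] mult_left_mono)
      qed measurable
      ultimately show "integrable lborel (\<lambda>x. \<integral>u. norm ((\<lambda>(x, u). ?g x u) (x, u)) \<partial>lborel)" by simp
      show "AE x in lborel. integrable lborel (\<lambda>u. (\<lambda>(x, u). ?g x u) (x, u))"
        unfolding prod.case
        by (intro AE_I2 integrable_mult_right integrable_of_real integrable.intros[OF P1])
    qed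
    from lborel_pair.Fubini_integral[OF this]
    have "(\<integral>u. (\<integral>x. ?g x u \<partial>lborel) \<partial>lborel) = (\<integral>x. (\<integral>u. ?g x u \<partial>lborel) \<partial>lborel)" .
    moreover have "(\<integral>x. ?g x u \<partial>lborel) = 0" for u
      using P[OF y, of u] by (cases "u \<in> {t..}") simp_all
    moreover have "(\<integral>u. ?g x u \<partial>lborel) = f x * of_real (pi / 2 - arctan ((t - x) / y))" for x
      using has_bochner_integral_integral_eq[OF P1, of x]
      by (simp only: integral_mult_right_zero integral_complex_of_real)
    ultimately show ?thesis by simp
  qed
  define a where "a n = 1 / real (n + 2)" for n
  have a: "0 < a n" "a n < 1" for n by (auto simp: a_def)
  let ?h = "\<lambda>x. indicator {t<..} x * f x"
  have "(\<lambda>n. \<integral>x. f x * of_real (pi / 2 - arctan ((t - x) / a n)) \<partial>lborel) \<longlonglongrightarrow> (\<integral>x. of_real pi * ?h x \<partial>lborel)"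
  proof (rule integral_dominated_convergence)
    show "integrable lborel (\<lambda>x. pi * cmod (f x))" using f by simp
    have "\<bar>pi / 2 - arctan s\<bar> \<le> pi" for s using arctan_ubound[of s] arctan_lbound[of s] by linarith
    then show "AE x in lborel. norm (f x * of_real (pi / 2 - arctan ((t - x) / a n))) \<le> pi * cmod (f x)" for n
      by (intro AE_I2) (simp only: norm_mult norm_of_real mult.commute[of pi] mult_left_mono norm_ge_zero)
    have lim: "(\<lambda>n. f x * of_real (pi / 2 - arctan ((t - x) / a n))) \<longlonglongrightarrow> of_real pi * ?h x" if "x \<noteq> t" for x
    proof (cases "t < x")
      case True
      have "filterlim (\<lambda>n. (t - x) / a n) at_bot sequentially" unfolding a_def using True by real_asymp
      from filterlim_compose[OF tendsto_arctan_at_bot this]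
      have "(\<lambda>n. f x * of_real (pi / 2 - arctan ((t - x) / a n))) \<longlonglongrightarrow> f x * of_real (pi / 2 - (- (pi / 2)))"
        by (intro tendsto_intros) 
      with True show ?thesis by (simp add: mult.commute)
    next
      case False
      with that have "x < t" by simp
      then have "filterlim (\<lambda>n. (t - x) / a n) at_top sequentially" unfolding a_def by real_asymp
      from filterlim_compose[OF tendsto_arctan_at_top this]
      have "(\<lambda>n. f x * of_real (pi / 2 - arctan ((t - x) / a n))) \<longlonglongrightarrow> f x * of_real (pi / 2 - pi / 2)"
        by (intro tendsto_intros)
      with False show ?thesis by simp
    qed
    then show "AE x in lborel. (\<lambda>n. f x * of_real (pi / 2 - arctan ((t - x) / a n))) \<longlonglongrightarrow> of_real pi * ?h x"
      using AE_lborel_singleton[of t] by (elim eventually_mono) auto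
  qed measurable
  then have "(\<integral>x. of_real pi * ?h x \<partial>lborel) = 0"
    unfolding T[OF a] by (rule LIMSEQ_unique[OF _ tendsto_const])
  then show "(\<integral>x. ?h x \<partial>lborel) = 0" by simp
qed

text \<open>Partial fractions: multiplication by a kernel acts on the Cauchy transform as a difference quotient. In particular
the vanishing of the transform is inherited by such products.\<close>
lemma cauchy_transform_mult_kernel:
  assumes f: "square_integrable f" and a: "Im a \<noteq> 0" and v: "Im v \<noteq> 0"
  shows "(a - v) * cauchy_transform (\<lambda>x. f x * cauchy_kernel a x) v = cauchy_transform f a - cauchy_transform f v"
proof -
  have ne: "of_real x \<noteq> a" "of_real x \<noteq> v" for x using a v by auto
  have "cauchy_transform f a - cauchy_transform f v = (\<integral>x. f x * cauchy_kernel a x - f x * cauchy_kernel v x \<partial>lborel)"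
    unfolding cauchy_transform_def
    by (intro Bochner_Integration.integral_diff[symmetric] square_integrable_mult f square_integrable_cauchy_kernel a v)
  also have "\<dots> = (\<integral>x. (a - v) * (f x * cauchy_kernel a x * cauchy_kernel v x) \<partial>lborel)"
    by (simp only: right_diff_distrib[symmetric] cauchy_kernel_mult[OF ne] mult_ac)
  finally show ?thesis unfolding cauchy_transform_def by simp
qed

text \<open>A square-integrable function need not be integrable; its product with a kernel is, and the transform of the product
vanishes by partial fractions away from the pole \<open>2 \<i>\<close> of that kernel.\<close>
lemma cauchy_transform_injective:
  assumes f: "square_integrable f" and zero: "\<And>v. Im v \<noteq> 0 \<Longrightarrow> cauchy_transform f v = 0"
  shows "AE x in lborel. f x = 0"
proof -
  have "integrable lborel (\<lambda>x. f x * cauchy_kernel (2 * \<i>) x)"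
    by (intro square_integrable_mult f square_integrable_cauchy_kernel) simp
  moreover have "cauchy_transform (\<lambda>x. f x * cauchy_kernel (2 * \<i>) x) v = 0" if "Im v \<noteq> 0" "\<bar>Im v\<bar> < 1" for v
    using cauchy_transform_mult_kernel[OF f, of "2 * \<i>" v] zero[of v] zero[of "2 * \<i>"] that by auto
  ultimately have "AE x in lborel. f x * cauchy_kernel (2 * \<i>) x = 0"
    by (rule cauchy_transform_injective_integrable)
  then show ?thesis
    by (elim eventually_mono) (simp add: cauchy_kernel_nonzero)
qed

text \<open>Kernels of points at positive distance from the support of a function are dominated by the square-integrable
kernel of \<open>\<i>\<close>. This also covers real points \<open>v\<close>, whose kernel is not square-integrable on the whole line.\<close>
lemma norm_cauchy_kernel_compare:
  assumes d: "dist (of_real x) v \<ge> d" "d > 0"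
  shows "cmod (cauchy_kernel v x) \<le> (1 + cmod (v - \<i>) / d) * cmod (cauchy_kernel \<i> x)"
proof -
  have pos: "cmod (of_real x - v) > 0" using d unfolding dist_norm by linarith
  have posi: "cmod (of_real x - \<i>) > 0" by (auto simp: complex_eq_iff)
  have "cmod (of_real x - \<i>) \<le> cmod (of_real x - v) + cmod (v - \<i>)"
    using norm_triangle_ineq[of "of_real x - v" "v - \<i>"] by simp
  also have "cmod (v - \<i>) = d * (cmod (v - \<i>) / d)" using d by simp
  also have "\<dots> \<le> cmod (of_real x - v) * (cmod (v - \<i>) / d)"
    using d by (intro mult_right_mono) (auto simp: dist_norm)
  finally have "cmod (of_real x - \<i>) \<le> (1 + cmod (v - \<i>) / d) * cmod (of_real x - v)"
    by (simp add: algebra_simps)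
  then show ?thesis
    using pos posi by (simp add: cauchy_kernel_def norm_divide pos_divide_le_eq pos_le_divide_eq mult.commute)
qed

lemma integrable_mult_cauchy_kernel:
  assumes f: "square_integrable f" and d: "d > 0"
    and supp: "AE x in lborel. f x \<noteq> 0 \<longrightarrow> dist (of_real x) v \<ge> d"
  shows "integrable lborel (\<lambda>x. f x * cauchy_kernel v x)"
proof (rule Bochner_Integration.integrable_bound)
  have "integrable lborel (\<lambda>x. f x * cauchy_kernel \<i> x)"
    by (intro square_integrable_mult f square_integrable_cauchy_kernel) simp
  then show "integrable lborel (\<lambda>x. (1 + cmod (v - \<i>) / d) * cmod (f x * cauchy_kernel \<i> x))"
    by (intro integrable_mult_right integrable_norm)
  have [measurable]: "f \<in> borel_measurable borel" using f by (simp add: square_integrable_def)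
  show "(\<lambda>x. f x * cauchy_kernel v x) \<in> borel_measurable lborel" by measurable
  show "AE x in lborel. norm (f x * cauchy_kernel v x) \<le>
      norm ((1 + cmod (v - \<i>) / d) * cmod (f x * cauchy_kernel \<i> x))"
    using supp
  proof eventually_elim
    case (elim x)
    show ?case
    proof (cases "f x = 0")
      case False
      with elim have "cmod (cauchy_kernel v x) \<le> (1 + cmod (v - \<i>) / d) * cmod (cauchy_kernel \<i> x)"
        using d by (intro norm_cauchy_kernel_compare) auto
      from mult_left_mono[OF this norm_ge_zero[of "f x"]] d
      show ?thesis by (simp add: norm_mult abs_mult mult_ac)
    qed simp
  qed
qed

text \<open>The derivative is obtained by differentiating the kernel under the integral sign. With \<open>p\<close> and \<open>q\<close> the kernels of \<open>v\<close>
and \<open>v + h\<close>, the resolvent identity \<open>q - p = h q p\<close> makes the error of the difference quotient equal to \<open>h p\<^sup>2 q\<close>.\<close>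
lemma cauchy_transform_field_differentiable:
  assumes f: "square_integrable f" and d: "d > 0"
    and supp: "AE x in lborel. f x \<noteq> 0 \<longrightarrow> dist (of_real x) v \<ge> 2 * d"
  shows "cauchy_transform f field_differentiable (at v)"
proof -
  have [measurable]: "f \<in> borel_measurable borel" using f by (simp add: square_integrable_def)
  define D where "D = (\<integral>x. f x * (cauchy_kernel v x)\<^sup>2 \<partial>lborel)"
  define M where "M = (\<integral>x. cmod (f x * cauchy_kernel v x) / d\<^sup>2 \<partial>lborel)"
  have iv: "integrable lborel (\<lambda>x. f x * cauchy_kernel v x)"
    by (rule integrable_mult_cauchy_kernel[OF f d]) (use supp d in \<open>auto elim!: eventually_mono\<close>)
  have iv2: "integrable lborel (\<lambda>x. f x * (cauchy_kernel v x)\<^sup>2)"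
  proof (rule Bochner_Integration.integrable_bound)
    show "integrable lborel (\<lambda>x. 1 / d * cmod (f x * cauchy_kernel v x))"
      by (intro integrable_mult_right integrable_norm iv)
    show "AE x in lborel. norm (f x * (cauchy_kernel v x)\<^sup>2) \<le> norm (1 / d * cmod (f x * cauchy_kernel v x))"
      using supp
    proof eventually_elim
      case (elim x)
      show ?case
      proof (cases "f x = 0")
        case False
        with elim have "cmod (cauchy_kernel v x) \<le> 1 / d"
          using d by (intro norm_cauchy_kernel_le) auto
        from mult_left_mono[OF this norm_ge_zero[of "f x * cauchy_kernel v x"]] d
        show ?thesis by (simp add: norm_mult power2_eq_square abs_mult mult_ac)
      qed simp
    qed
  qed measurable
  have bound: "cmod ((cauchy_transform f (v + h) - cauchy_transform f v) / h - D) \<le> cmod h * M"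
    if h: "h \<noteq> 0" "cmod h < d" for h
  proof -
    have supp_h: "AE x in lborel. f x \<noteq> 0 \<longrightarrow> dist (of_real x) (v + h) \<ge> d"
      using supp
    proof eventually_elim
      case (elim x)
      have "dist (of_real x) v \<le> dist (of_real x) (v + h) + cmod h"
        using dist_triangle[of "of_real x" v "v + h"] by (simp add: dist_norm)
      then show ?case using elim h(2) by auto
    qed
    have ih: "integrable lborel (\<lambda>x. f x * cauchy_kernel (v + h) x)"
      by (rule integrable_mult_cauchy_kernel[OF f d supp_h])
    have "(cauchy_transform f (v + h) - cauchy_transform f v) / h - D =
        (\<integral>x. (f x * cauchy_kernel (v + h) x - f x * cauchy_kernel v x) / h - f x * (cauchy_kernel v x)\<^sup>2 \<partial>lborel)"
      unfolding cauchy_transform_def D_def using ih iv iv2 h by simp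
    also have "cmod \<dots> \<le> (\<integral>x. cmod h * (cmod (f x * cauchy_kernel v x) / d\<^sup>2) \<partial>lborel)"
    proof (rule order_trans[OF integral_norm_bound integral_mono_AE])
      show "integrable lborel (\<lambda>x. cmod ((f x * cauchy_kernel (v + h) x - f x * cauchy_kernel v x) / h - f x * (cauchy_kernel v x)\<^sup>2))"
        using ih iv iv2 h by (intro integrable_norm) simp
      show "integrable lborel (\<lambda>x. cmod h * (cmod (f x * cauchy_kernel v x) / d\<^sup>2))"
        using iv by simp
      show "AE x in lborel. cmod ((f x * cauchy_kernel (v + h) x - f x * cauchy_kernel v x) / h - f x * (cauchy_kernel v x)\<^sup>2)
          \<le> cmod h * (cmod (f x * cauchy_kernel v x) / d\<^sup>2)"
        using supp supp_h
      proof eventually_elim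
        case (elim x)
        show ?case
        proof (cases "f x = 0")
          case False
          define p q where "p = cauchy_kernel v x" and "q = cauchy_kernel (v + h) x"
          from False elim have le: "cmod p \<le> 1 / d" "cmod q \<le> 1 / d"
            using d unfolding p_def q_def by (auto intro!: norm_cauchy_kernel_le)
          from False elim d have "of_real x \<noteq> v + h" "of_real x \<noteq> v" by auto
          from cauchy_kernel_mult[OF this] have qp: "q - p = h * (q * p)" by (simp add: p_def q_def)
          have "(f x * q - f x * p) / h - f x * p\<^sup>2 = f x * ((q - p) / h) - f x * (p * p)"
            by (simp add: right_diff_distrib power2_eq_square)
          also have "(q - p) / h = q * p" unfolding qp using h by simp
          also have "f x * (q * p) - f x * (p * p) = f x * p * (q - p)" by (simp add: algebra_simps)
          finally have eq: "(f x * q - f x * p) / h - f x * p\<^sup>2 = f x * p * h * (p * q)"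
            unfolding qp by (simp add: mult_ac)
          have "cmod (p * q) \<le> 1 / d * (1 / d)"
            unfolding norm_mult using le d by (intro mult_mono) auto
          from mult_left_mono[OF this norm_ge_zero[of "f x * p * h"]]
          show ?thesis unfolding p_def[symmetric] q_def[symmetric] eq
            by (simp add: norm_mult power2_eq_square mult_ac)
        qed simp
      qed
    qed
    also have "\<dots> = cmod h * M" unfolding M_def by simp
    finally show ?thesis .
  qed
  have "((\<lambda>h. (cauchy_transform f (v + h) - cauchy_transform f v) / h - D) \<longlongrightarrow> 0) (at 0)"
  proof (rule Lim_null_comparison)
    show "\<forall>\<^sub>F h in at 0. norm ((cauchy_transform f (v + h) - cauchy_transform f v) / h - D) \<le> cmod h * M"
      unfolding eventually_at using d bound by (intro exI[of _ d]) (auto simp: dist_norm)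
    have "((\<lambda>h::complex. cmod h * M) \<longlongrightarrow> cmod 0 * M) (at 0)" by (intro tendsto_intros)
    then show "((\<lambda>h::complex. cmod h * M) \<longlongrightarrow> 0) (at 0)" by simp
  qed
  then have "(cauchy_transform f has_field_derivative D) (at v)"
    unfolding DERIV_def by (simp add: LIM_zero_iff)
  then show ?thesis by (auto simp: field_differentiable_def)
qed

text \<open>The support condition makes the Cauchy transform holomorphic on the plane slit along \<open>[0,\<infinity>)\<close>. This domain is connected
and contains both half planes, so vanishing on \<open>U\<close> propagates through the negative half-line from one half plane
to the other, and injectivity applies. This replaces a theorem of the brothers Riesz on boundary zeros of Hardy functions.\<close>
theorem cauchy_transform_uniqueness:
  assumes f: "square_integrable f" and supp: "AE x in lborel. x < 0 \<longrightarrow> f x = 0"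
    and U: "open U" "U \<noteq> {}" "\<And>v. v \<in> U \<Longrightarrow> Im v \<noteq> 0" "\<And>v. v \<in> U \<Longrightarrow> cauchy_transform f v = 0"
  shows "AE x in lborel. f x = 0"
proof (rule cauchy_transform_injective[OF f])
  define D where "D = - (complex_of_real ` {0..})"
  have "open D"
    unfolding D_def by (intro open_Compl closed_slot_right)
  have "connected D"
    unfolding D_def by (intro starlike_imp_connected starlike_slotted_complex_plane_right)
  have nonreal: "v \<in> D" if "Im v \<noteq> 0" for v using that by (auto simp: D_def)
  have "cauchy_transform f holomorphic_on D"
  proof (rule holomorphic_onI)
    fix v assume "v \<in> D"
    then obtain e where e: "e > 0" "ball v e \<subseteq> D" using \<open>open D\<close> openE by blast
    have far: "dist (of_real x) v \<ge> 2 * (e / 2)" if "x \<ge> 0" for x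
    proof (rule ccontr)
      assume "\<not> ?thesis"
      then have "of_real x \<in> ball v e" by (simp add: dist_commute)
      with e that show False by (auto simp: D_def)
    qed
    have "AE x in lborel. f x \<noteq> 0 \<longrightarrow> dist (of_real x) v \<ge> 2 * (e / 2)"
      using supp by (elim eventually_mono) (use far in force)
    then show "cauchy_transform f field_differentiable at v within D"
      using cauchy_transform_field_differentiable[OF f, of "e / 2" v] e field_differentiable_at_within by auto
  qed
  then show "cauchy_transform f v = 0" if "Im v \<noteq> 0" for v
    using analytic_continuation_open[OF \<open>open U\<close> \<open>open D\<close> U(2) \<open>connected D\<close>, of "cauchy_transform f" "\<lambda>_. 0" v]
      U(3,4) nonreal that by (auto simp: holomorphic_on_const)
qed

section \<open>Representatives of classes\<close>

lemma square_integrable_rep [simp]: "square_integrable (rep_L2R f)"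
  using Quotient3_rep_reflp[OF Quotient3_L2R, of f] by simp

lemma abs_rep_L2R [simp]: "abs_L2R (rep_L2R f) = f"
  by (rule Quotient3_abs_rep[OF Quotient3_L2R])

lemma rep_abs_L2R: "square_integrable h \<Longrightarrow> AE x in lborel. rep_L2R (abs_L2R h) x = h x"
  using rep_abs_rsp_left[OF Quotient3_L2R, of h h] by simp

lemma L2R_eqI: "AE x in lborel. rep_L2R f x = rep_L2R g x \<Longrightarrow> f = g"
  using Quotient3_rel_rep[OF Quotient3_L2R, of f g] by simp

lemma cinner_rep: "cinner f g = (\<integral>x. rep_L2R f x * cnj (rep_L2R g x) \<partial>lborel)"
  by (simp add: cinner_def)

lemma measurable_rep [measurable]: "rep_L2R f \<in> borel_measurable borel"
  using square_integrable_rep[of f] by (simp add: square_integrable_def)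

lemma measurable_cnj_rep [measurable]: "(\<lambda>x. cnj (rep_L2R f x)) \<in> borel_measurable borel"
  by (intro borel_measurable_continuous_on[where f = cnj]) (auto intro!: continuous_intros)

lemma rep_scaleR: "AE x in lborel. rep_L2R (c *\<^sub>R f) x = of_real c * rep_L2R f x"
  unfolding scaleR_L2R_def scaleC_def
  using rep_abs_L2R[OF square_integrable_cmult[OF square_integrable_rep]] by simp

lemma L2R_eq_0I: "AE x in lborel. rep_L2R f x = 0 \<Longrightarrow> f = 0"
proof -
  have "AE x in lborel. rep_L2R 0 x = 0"
    unfolding zero_L2R_def by (rule rep_abs_L2R) simp
  then show "f = 0" if "AE x in lborel. rep_L2R f x = 0"
    using that by (intro L2R_eqI) (auto elim: eventually_elim2)
qed

lemma
  shows cinner_diff_left: "cinner (f - g) h = cinner f h - cinner g h"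
    and cinner_scaleR_left: "cinner (c *\<^sub>R f) h = of_real c * cinner f h"
    and cinner_scaleR_right: "cinner h (c *\<^sub>R f) = of_real c * cinner h f"
proof -
  show left: "cinner (c *\<^sub>R f) h = of_real c * cinner f h" for c f h
    by (simp add: scaleR_L2R_def cinner_scaleC_left)
  show "cinner h (c *\<^sub>R f) = of_real c * cinner h f"
    by (metis cinner_commute left complex_cnj_mult complex_cnj_complex_of_real)
  have "cinner (f - g) h + cinner g h = cinner f h"
    by (simp add: cinner_add_left[symmetric])
  then show "cinner (f - g) h = cinner f h - cinner g h" by (simp add: algebra_simps)
qed

lemma rep_diff: "AE x in lborel. rep_L2R (f - g) x = rep_L2R f x - rep_L2R g x"
proof -
  have "AE x in lborel. rep_L2R (f + h) x = rep_L2R f x + rep_L2R h x" for h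
    unfolding plus_L2R_def using rep_abs_L2R[OF square_integrable_add[of "rep_L2R f" "rep_L2R h"]] by simp
  moreover have "AE x in lborel. rep_L2R (- g) x = - rep_L2R g x"
    unfolding uminus_L2R_def using rep_abs_L2R[OF square_integrable_cmult[of "rep_L2R g" "-1"]] by simp
  ultimately have "AE x in lborel. rep_L2R (f + - g) x = rep_L2R f x + rep_L2R (- g) x"
    "AE x in lborel. rep_L2R (- g) x = - rep_L2R g x" by blast+
  then show ?thesis unfolding minus_L2R_def by eventually_elim simp
qed

section \<open>Szego kernels and the Hardy space\<close>

text \<open>For \<open>w\<close> in the upper half plane this is, up to the factor \<open>- 1 / (2 \<pi> \<i>)\<close>, the reproducing kernel of \<open>H\<^sup>2\<close>
at \<open>w\<close>. For \<open>w\<close> in the lower half plane it belongs to the orthogonal complement of \<open>H\<^sup>2\<close>.\<close>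
definition szego_kernel :: "complex \<Rightarrow> L2R" where
  "szego_kernel w = abs_L2R (cauchy_kernel (cnj w))"

lemma rep_szego_kernel:
  "Im w \<noteq> 0 \<Longrightarrow> AE x in lborel. rep_L2R (szego_kernel w) x = cauchy_kernel (cnj w) x"
  unfolding szego_kernel_def by (intro rep_abs_L2R square_integrable_cauchy_kernel) simp

lemma cinner_szego_kernel:
  assumes "Im w \<noteq> 0"
  shows "cinner f (szego_kernel w) = cauchy_transform (rep_L2R f) w"
  unfolding cinner_rep cauchy_transform_def
proof (rule integral_cong_AE)
  show "AE x in lborel. rep_L2R f x * cnj (rep_L2R (szego_kernel w) x) = rep_L2R f x * cauchy_kernel w x"
    using rep_szego_kernel[OF assms] by (elim eventually_mono) (simp add: cnj_cauchy_kernel)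
qed measurable

text \<open>The function \<open>z \<mapsto> 1 / (z - cnj w)\<close> has its pole below the real line. Its restrictions to horizontal lines are again Cauchy
kernels, whose norms are known, and the resolvent identity gives the rate of convergence to the boundary.\<close>
lemma szego_kernel_in_H2:
  assumes "Im w > 0"
  shows "szego_kernel w \<in> H2"
proof -
  define F where "F z = 1 / (z - cnj w)" for z
  define J where "J = (\<integral>x. inverse (1 + x\<^sup>2) \<partial>(lborel :: real measure))"
  have "J \<ge> 0" unfolding J_def by (intro integral_nonneg_AE AE_I2) auto
  have F_line: "F (Complex x y) = cauchy_kernel (cnj w - \<i> * y) x" for x y
    by (simp add: F_def cauchy_kernel_def Complex_eq algebra_simps)
  have line: "(\<integral>\<^sup>+x. ennreal ((cmod (cauchy_kernel (cnj w - \<i> * y) x))\<^sup>2) \<partial>lborel) = ennreal (J / (Im w + y))"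
    if "y \<ge> 0" for y :: real
  proof -
    have im: "Im (cnj w - \<i> * y) \<noteq> 0" "\<bar>Im (cnj w - \<i> * y)\<bar> = Im w + y" using assms that by auto
    have "(\<integral>\<^sup>+x. ennreal ((cmod (cauchy_kernel (cnj w - \<i> * y) x))\<^sup>2) \<partial>lborel) =
        ennreal (\<integral>x. (cmod (cauchy_kernel (cnj w - \<i> * y) x))\<^sup>2 \<partial>lborel)"
      using square_integrable_cauchy_kernel[OF im(1)]
      by (intro nn_integral_eq_integral) (auto simp: square_integrable_def)
    then show ?thesis
      unfolding integral_norm_cauchy_kernel_squared[OF im(1)] im(2) J_def .
  qed
  have "hardy_function F"
    unfolding hardy_function_def
  proof (intro conjI exI allI impI)
    show "F holomorphic_on upper_half_plane"
      unfolding F_def using assms by (intro holomorphic_intros) (auto simp: upper_half_plane_def complex_eq_iff)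
    show "(\<integral>\<^sup>+x. ennreal ((cmod (F (Complex x y)))\<^sup>2) \<partial>lborel) \<le> ennreal (J / Im w)" if "y > 0" for y
      unfolding F_line using that assms \<open>J \<ge> 0\<close>
      by (subst line) (auto intro!: ennreal_leI divide_left_mono)
  qed
  moreover have "boundary_value F (szego_kernel w)"
  proof -
    have le: "(\<integral>\<^sup>+x. ennreal ((cmod (F (Complex x y) - rep_L2R (szego_kernel w) x))\<^sup>2) \<partial>lborel)
        \<le> ennreal ((y / Im w)\<^sup>2 * (J / Im w))" if y: "y > 0" for y
    proof -
      let ?k = "cauchy_kernel (cnj w)" and ?k' = "cauchy_kernel (cnj w - \<i> * y)"
      have "(\<integral>\<^sup>+x. ennreal ((cmod (F (Complex x y) - rep_L2R (szego_kernel w) x))\<^sup>2) \<partial>lborel)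
          \<le> (\<integral>\<^sup>+x. ennreal ((y / Im w)\<^sup>2) * ennreal ((cmod (?k x))\<^sup>2) \<partial>lborel)"
      proof (rule nn_integral_mono_AE)
        have "AE x in lborel. rep_L2R (szego_kernel w) x = ?k x"
          using assms by (intro rep_szego_kernel) auto
        then show "AE x in lborel. ennreal ((cmod (F (Complex x y) - rep_L2R (szego_kernel w) x))\<^sup>2)
            \<le> ennreal ((y / Im w)\<^sup>2) * ennreal ((cmod (?k x))\<^sup>2)"
        proof eventually_elim
          case (elim x)
          have "of_real x \<noteq> cnj w - \<i> * y" "of_real x \<noteq> cnj w" using assms y by (auto simp: complex_eq_iff)
          then have "?k' x - ?k x = (cnj w - \<i> * y - cnj w) * (?k' x * ?k x)"
            by (rule cauchy_kernel_mult)
          then have "cmod (?k' x - ?k x) = y * cmod (?k' x) * cmod (?k x)"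
            using y by (simp add: norm_mult)
          moreover have "cmod (?k' x) \<le> 1 / Im w"
            using assms y abs_Im_le_cmod[of "of_real x - (cnj w - \<i> * y)"]
            by (intro norm_cauchy_kernel_le) (auto simp: dist_norm)
          ultimately have "cmod (?k' x - ?k x) \<le> y / Im w * cmod (?k x)"
            using mult_right_mono[OF mult_left_mono[of "cmod (?k' x)" "1 / Im w" y], of "cmod (?k x)"] y by simp
          then have "(cmod (?k' x - ?k x))\<^sup>2 \<le> (y / Im w)\<^sup>2 * (cmod (?k x))\<^sup>2"
            unfolding power_mult_distrib[symmetric] by (rule power_mono) simp
          with elim show ?case
            unfolding F_line by (simp add: ennreal_mult[symmetric] ennreal_leI)
        qed
      qed
      also have "\<dots> = ennreal ((y / Im w)\<^sup>2) * ennreal (J / Im w)"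
        using line[of 0] by (subst nn_integral_cmult) auto
      finally show ?thesis using assms \<open>J \<ge> 0\<close> by (simp add: ennreal_mult[symmetric])
    qed
    have "((\<lambda>y. (y / Im w)\<^sup>2 * (J / Im w)) \<longlongrightarrow> (0 / Im w)\<^sup>2 * (J / Im w)) (at_right 0)"
      using assms by (intro tendsto_intros) auto
    then have "((\<lambda>y. ennreal ((y / Im w)\<^sup>2 * (J / Im w))) \<longlongrightarrow> 0) (at_right 0)"
      using tendsto_ennrealI by force
    then have "((\<lambda>y. \<integral>\<^sup>+x. ennreal ((cmod (F (Complex x y) - rep_L2R (szego_kernel w) x))\<^sup>2) \<partial>lborel) \<longlongrightarrow> 0) (at_right 0)"
      by (rule tendsto_sandwich[OF _ _ tendsto_const, rotated 2])
         (use le in \<open>auto intro: eventually_mono[OF eventually_at_right_less]\<close>)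
    then show ?thesis by (simp add: boundary_value_def)
  qed
  ultimately show ?thesis unfolding H2_def by blast
qed

lemma H2_orthogonal_lower_szego_kernel:
  assumes "f \<in> H2" "Im v < 0"
  shows "cinner f (szego_kernel v) = 0"
proof -
  obtain F where "hardy_function F" "boundary_value F f" using assms(1) by (auto simp: H2_def)
  then show ?thesis
    using cauchy_transform_boundary_value_zero[of F "rep_L2R f" v] assms(2)
    by (simp add: cinner_szego_kernel boundary_value_def)
qed

lemma H2_in_subspace_lattice: "H2 \<in> subspace_lattice"
proof -
  have "modulate 0 ` H2 = H2" by (simp add: modulate_def)
  then have "H2 \<in> {modulate \<beta> ` H2 |\<beta>. \<beta> \<ge> 0}" by (intro CollectI exI[of _ 0]) simp
  then show ?thesis unfolding subspace_lattice_def by blast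
qed

lemma szego_kernel_nonzero:
  assumes "Im w \<noteq> 0"
  shows "szego_kernel w \<noteq> 0"
proof
  assume "szego_kernel w = 0"
  moreover have "AE x in lborel. rep_L2R 0 x = 0"
    unfolding zero_L2R_def by (rule rep_abs_L2R) simp
  ultimately have "AE x in lborel. cauchy_kernel (cnj w) x = 0"
    using rep_szego_kernel[OF assms] by (auto elim: eventually_elim2)
  then show False
    using assms by (simp add: cauchy_kernel_nonzero eventually_False ae_filter_eq_bot_iff)
qed

lemma szego_kernel_total:
  assumes "\<And>v. Im v \<noteq> 0 \<Longrightarrow> cinner f (szego_kernel v) = 0"
  shows "f = 0"
  using assms by (intro L2R_eq_0I cauchy_transform_injective square_integrable_rep)
    (simp add: cinner_szego_kernel)

text \<open>Dually: \<open>L\<^sup>2(-\<infinity>,0)\<close> and the Szego kernels of the upper half plane together span a dense subspace. A bounded operator that acts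
as the same scalar on both is therefore that scalar everywhere.\<close>
lemma upper_szego_kernel_total:
  assumes neg: "AE x in lborel. x < 0 \<longrightarrow> rep_L2R f x = 0"
    and ortho: "\<And>v. Im v > 0 \<Longrightarrow> cinner f (szego_kernel v) = 0"
  shows "f = 0"
proof (intro L2R_eq_0I cauchy_transform_uniqueness[OF square_integrable_rep neg])
  show "open {z. Im z > 0}" by (rule open_halfspace_Im_gt)
  have "\<i> \<in> {z. Im z > 0}" by simp
  then show "{z. Im z > 0} \<noteq> {}" by blast
  show "cauchy_transform (rep_L2R f) v = 0" if "v \<in> {z. Im z > 0}" for v
    using ortho[of v] that by (simp add: cinner_szego_kernel)
qed auto

section \<open>Locality on the negative half-line\<close>

definition restrict_L2R :: "real set \<Rightarrow> L2R \<Rightarrow> L2R" where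
  "restrict_L2R S f = abs_L2R (\<lambda>x. indicator S x * rep_L2R f x)"

lemma rep_restrict_L2R:
  assumes "S \<in> sets borel"
  shows "AE x in lborel. rep_L2R (restrict_L2R S f) x = indicator S x * rep_L2R f x"
  unfolding restrict_L2R_def
  using assms by (intro rep_abs_L2R square_integrable_dominated[OF square_integrable_rep, of _ 1 f])
    (auto split: split_indicator)

lemma restrict_L2R_in_L2_on: "S \<in> sets borel \<Longrightarrow> restrict_L2R S f \<in> L2_on S"
  using rep_restrict_L2R[of S f]
  by (auto simp: L2_on_def vanishes_off_def elim: eventually_mono)

lemma restrict_L2R_ident:
  assumes "S \<in> sets borel" "f \<in> L2_on S"
  shows "restrict_L2R S f = f"
proof (rule L2R_eqI)
  have "AE x in lborel. x \<notin> S \<longrightarrow> rep_L2R f x = 0"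
    using assms(2) by (simp add: L2_on_def vanishes_off_def)
  with rep_restrict_L2R[OF assms(1), of f]
  show "AE x in lborel. rep_L2R (restrict_L2R S f) x = rep_L2R f x"
    by eventually_elim (auto split: split_indicator)
qed

lemma
  assumes [measurable]: "S \<in> sets borel"
  shows cinner_restrict_L2R_left:
      "cinner (restrict_L2R S f) g = (\<integral>x. indicator S x * (rep_L2R f x * cnj (rep_L2R g x)) \<partial>lborel)"
    and cinner_restrict_L2R_right:
      "cinner f (restrict_L2R S g) = (\<integral>x. indicator S x * (rep_L2R f x * cnj (rep_L2R g x)) \<partial>lborel)"
proof -
  show "cinner (restrict_L2R S f) g = (\<integral>x. indicator S x * (rep_L2R f x * cnj (rep_L2R g x)) \<partial>lborel)"
    unfolding cinner_rep
  proof (rule integral_cong_AE)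
    show "AE x in lborel. rep_L2R (restrict_L2R S f) x * cnj (rep_L2R g x) =
        indicator S x * (rep_L2R f x * cnj (rep_L2R g x))"
      using rep_restrict_L2R[OF assms, of f] by (elim eventually_mono) simp
  qed measurable
  show "cinner f (restrict_L2R S g) = (\<integral>x. indicator S x * (rep_L2R f x * cnj (rep_L2R g x)) \<partial>lborel)"
    unfolding cinner_rep
  proof (rule integral_cong_AE)
    show "AE x in lborel. rep_L2R f x * cnj (rep_L2R (restrict_L2R S g) x) =
        indicator S x * (rep_L2R f x * cnj (rep_L2R g x))"
      using rep_restrict_L2R[OF assms, of g] by (elim eventually_mono) (auto split: split_indicator)
  qed measurable
qed

text \<open>Write \<open>P\<close> for the orthogonal projection onto \<open>L\<^sup>2(t,\<infinity>)\<close>. Invariance says \<open>P A P = A P\<close>, and taking adjoints gives \<open>P A = A P\<close>; the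
two integrals are \<open>\<langle>P A f, g\<rangle>\<close> and \<open>\<langle>A P f, g\<rangle>\<close>.\<close>
lemma selfadjoint_Alg_ray_integral:
  assumes A: "A \<in> Alg subspace_lattice" "selfadjoint A" and t: "t \<le> 0"
  shows "(\<integral>x. indicator {t<..} x * (rep_L2R (A f) x * cnj (rep_L2R g x)) \<partial>lborel) =
         (\<integral>x. indicator {t<..} x * (rep_L2R f x * cnj (rep_L2R (A g) x)) \<partial>lborel)"
proof -
  let ?P = "restrict_L2R {t<..}"
  have "L2_on {- (- t)<..} \<in> subspace_lattice"
    unfolding subspace_lattice_def using t by (intro UnI1 UnI2 CollectI exI[of _ "- t"]) auto
  then have "A ` L2_on {t<..} \<subseteq> L2_on {t<..}"
    using A(1) by (simp add: Alg_def)
  then have fixed: "?P (A (?P h)) = A (?P h)" for h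
    using restrict_L2R_in_L2_on[of "{t<..}" h] by (intro restrict_L2R_ident) auto
  have sa: "cinner (A f) g = cinner f (A g)" for f g
    using A(2) by (simp add: selfadjoint_def)
  have sym: "cinner (?P f) g = cinner f (?P g)" for f g
    by (simp add: cinner_restrict_L2R_left cinner_restrict_L2R_right)
  have "cinner (A f) (?P g) = cinner f (?P (A (?P g)))" by (simp add: fixed sa)
  also have "\<dots> = cinner (?P (A (?P f))) g" by (simp only: sym[symmetric] sa[symmetric])
  also have "\<dots> = cinner (?P f) (A g)" by (simp add: fixed sa)
  finally show ?thesis
    by (simp add: cinner_restrict_L2R_left cinner_restrict_L2R_right)
qed

text \<open>The integrals of the difference of the two sides over \<open>(t,0]\<close> vanish for every \<open>t \<le> 0\<close>, as differences of
integrals over rays.\<close>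
lemma selfadjoint_Alg_local:
  assumes A: "A \<in> Alg subspace_lattice" "selfadjoint A"
  shows "AE x in lborel. x < 0 \<longrightarrow> rep_L2R (A f) x * cnj (rep_L2R g x) = rep_L2R f x * cnj (rep_L2R (A g) x)"
proof -
  let ?h = "\<lambda>x. rep_L2R (A f) x * cnj (rep_L2R g x) - rep_L2R f x * cnj (rep_L2R (A g) x)"
  have int: "integrable lborel ?h"
    by (intro Bochner_Integration.integrable_diff square_integrable_mult_cnj square_integrable_rep)
  have int_ind: "integrable lborel (\<lambda>x. indicator S x * u x)"
    if "S \<in> sets borel" "integrable lborel u" for S :: "real set" and u :: "real \<Rightarrow> complex"
  proof -
    have "(\<lambda>x. indicator S x * u x) = (\<lambda>x. indicator S x *\<^sub>R u x)" by (auto split: split_indicator)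
    then show ?thesis using integrable_mult_indicator[of S lborel u] that by simp
  qed
  have ray: "(\<integral>x. indicator {t<..} x * ?h x \<partial>lborel) = 0" if "t \<le> 0" for t
    unfolding right_diff_distrib
    by (subst Bochner_Integration.integral_diff)
       (auto intro!: int_ind square_integrable_mult_cnj simp: selfadjoint_Alg_ray_integral[OF A that])
  have "AE x in lborel. indicator {..0} x * ?h x = 0"
  proof (rule AE_zero_if_ray_integrals_zero)
    show "integrable lborel (\<lambda>x. indicator {..0} x * ?h x)" by (intro int_ind int) simp
    show "(\<integral>x. indicator {t<..} x * (indicator {..0} x * ?h x) \<partial>lborel) = 0" for t
    proof (cases "t \<le> 0")
      case True
      have "(\<integral>x. indicator {t<..} x * (indicator {..0} x * ?h x) \<partial>lborel) =
          (\<integral>x. indicator {t<..} x * ?h x - indicator {0<..} x * ?h x \<partial>lborel)"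
        using True by (intro Bochner_Integration.integral_cong) (auto split: split_indicator)
      also have "\<dots> = 0"
        using ray[OF True] ray[of 0] by (subst Bochner_Integration.integral_diff) (auto intro!: int_ind int)
      finally show ?thesis .
    next
      case False
      then have "(\<lambda>x. indicator {t<..} x * (indicator {..0} x * ?h x)) = (\<lambda>x. 0)"
        by (auto split: split_indicator)
      then show ?thesis by simp
    qed
  qed
  then show ?thesis by (elim eventually_mono) (auto split: split_indicator_asm)
qed

section \<open>The action on Szego kernels\<close>

text \<open>Let \<open>\<phi>\<^sub>w\<close> represent \<open>A k\<^sub>w\<close>. Locality against \<open>k\<^sub>v\<close> gives \<open>(x - cnj w) \<phi>\<^sub>w(x) = (x - v) cnj (\<phi>\<^sub>v(x))\<close> for \<open>x < 0\<close>;
the right-hand side is free of \<open>w\<close>, so with \<open>w = v\<close> it equals \<open>(x - cnj v) \<phi>\<^sub>v(x)\<close>. To stay within square-integrable functions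
this equality is divided by \<open>x - cnj w\<close>, which yields the function \<open>h\<close> in the proof. Its Cauchy transform vanishes in the lower half
plane by partial fractions, except possibly at the pole \<open>cnj w\<close>, so the uniqueness theorem gives \<open>h = 0\<close>.
Reading the transform of \<open>h\<close> in the upper half plane shows that \<open>(u - cnj w) \<langle>A k\<^sub>w, k\<^sub>u\<rangle>\<close> does not depend on \<open>w\<close>. Interchanging the
two kernels by selfadjointness then removes the dependence on \<open>u\<close>.\<close>
lemma selfadjoint_Alg_szego_kernel:
  assumes A: "A \<in> Alg subspace_lattice" "selfadjoint A"
  obtains \<mu> where "cnj \<mu> = - \<mu>"
    "\<And>w v. Im w > 0 \<Longrightarrow> Im v > 0 \<Longrightarrow> (v - cnj w) * cinner (A (szego_kernel w)) (szego_kernel v) = \<mu>"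
proof -
  define \<phi> where "\<phi> w = rep_L2R (A (szego_kernel w))" for w
  have sq: "square_integrable (\<phi> w)" for w by (simp add: \<phi>_def)
  have "A ` H2 \<subseteq> H2" using A(1) H2_in_subspace_lattice by (auto simp: Alg_def)
  then have lower: "cauchy_transform (\<phi> w) u = 0" if "Im w > 0" "Im u < 0" for w u
    using H2_orthogonal_lower_szego_kernel[of "A (szego_kernel w)" u] szego_kernel_in_H2[OF that(1)] that(2)
    by (auto simp: \<phi>_def cinner_szego_kernel)
  have relation: "AE x in lborel. x < 0 \<longrightarrow> (of_real x - cnj w) * \<phi> w x = (of_real x - v) * cnj (\<phi> v x)"
    if "Im w > 0" "Im v > 0" for w v
  proof -
    have "AE x in lborel. x < 0 \<longrightarrow> \<phi> w x * cnj (rep_L2R (szego_kernel v) x) = rep_L2R (szego_kernel w) x * cnj (\<phi> v x)"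
      unfolding \<phi>_def by (rule selfadjoint_Alg_local[OF A])
    moreover have "AE x in lborel. rep_L2R (szego_kernel w) x = cauchy_kernel (cnj w) x"
      "AE x in lborel. rep_L2R (szego_kernel v) x = cauchy_kernel (cnj v) x"
      using that by (auto intro!: rep_szego_kernel)
    ultimately show ?thesis
    proof eventually_elim
      case (elim x)
      have "of_real x - v \<noteq> 0" "of_real x - cnj w \<noteq> 0" using that by (auto simp: complex_eq_iff)
      with elim show ?case by (auto simp: cauchy_kernel_def field_simps)
    qed
  qed
  have indep: "(u - cnj w) * cauchy_transform (\<phi> w) u = (u - cnj v) * cauchy_transform (\<phi> v) u"
    if w: "Im w > 0" and v: "Im v > 0" and u: "Im u > 0" for w v u
  proof -
    define h where "h x = \<phi> w x - (\<phi> v x + (cnj w - cnj v) * (\<phi> v x * cauchy_kernel (cnj w) x))" for x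
    \<comment> \<open>\<open>?p\<close> is the term that arises from \<open>(x - cnj v)/(x - cnj w) = 1 + (cnj w - cnj v)/(x - cnj w)\<close>.\<close>
    let ?p = "\<lambda>x. \<phi> v x * cauchy_kernel (cnj w) x"
    have nr: "Im (cnj w) \<noteq> 0" using w by simp
    have sqp: "square_integrable ?p"
    proof (rule square_integrable_dominated[OF sq[of v]])
      show "?p \<in> borel_measurable lborel" unfolding \<phi>_def by measurable
      show "cmod (?p x) \<le> 1 / Im w * cmod (\<phi> v x)" for x
      proof -
        have "cmod (cauchy_kernel (cnj w) x) \<le> 1 / Im w"
          using w abs_Im_le_cmod[of "of_real x - cnj w"] by (intro norm_cauchy_kernel_le) (auto simp: dist_norm)
        from mult_left_mono[OF this norm_ge_zero[of "\<phi> v x"]] show ?thesis by (simp add: norm_mult mult.commute)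
      qed
    qed
    have sqh: "square_integrable h"
      unfolding h_def by (intro square_integrable_diff square_integrable_add square_integrable_cmult sq sqp)
    have transform_h: "cauchy_transform h z = cauchy_transform (\<phi> w) z -
        (cauchy_transform (\<phi> v) z + (cnj w - cnj v) * cauchy_transform ?p z)" if "Im z \<noteq> 0" for z
    proof -
      note k = square_integrable_cauchy_kernel[OF that]
      note i = square_integrable_mult[OF sq[of w] k] square_integrable_mult[OF sq[of v] k] square_integrable_mult[OF sqp k]
      have "cauchy_transform h z = (\<integral>x. \<phi> w x * cauchy_kernel z x -
          (\<phi> v x * cauchy_kernel z x + (cnj w - cnj v) * (?p x * cauchy_kernel z x)) \<partial>lborel)"
        unfolding cauchy_transform_def h_def by (simp add: algebra_simps)
      then show ?thesis using i unfolding cauchy_transform_def by simp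
    qed
    have transform_p: "(cnj w - z) * cauchy_transform ?p z = - cauchy_transform (\<phi> v) z" if "Im z \<noteq> 0" for z
      using cauchy_transform_mult_kernel[OF sq[of v] nr that] lower[OF v, of "cnj w"] w by simp
    have "AE x in lborel. h x = 0"
    proof (rule cauchy_transform_uniqueness[OF sqh])
      show "AE x in lborel. x < 0 \<longrightarrow> h x = 0"
        using relation[OF w v] relation[OF v v]
      proof eventually_elim
        case (elim x)
        show ?case
        proof
          assume "x < 0"
          with elim have "(of_real x - cnj w) * \<phi> w x = (of_real x - cnj v) * \<phi> v x" by simp
          moreover have ne: "of_real x - cnj w \<noteq> 0" using w by (auto simp: complex_eq_iff)
          then have "(of_real x - cnj w) * h x = (of_real x - cnj w) * \<phi> w x - (of_real x - cnj v) * \<phi> v x"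
            by (simp add: h_def cauchy_kernel_def field_simps)
          ultimately show "h x = 0" using ne by simp
        qed
      qed
      show "open ({z. Im z < 0} - {cnj w})" by (intro open_Diff open_halfspace_Im_lt) simp
      have "cnj w - \<i> \<in> {z. Im z < 0} - {cnj w}" using w by simp
      then show "{z. Im z < 0} - {cnj w} \<noteq> {}" by blast
      show "Im z \<noteq> 0" if "z \<in> {z. Im z < 0} - {cnj w}" for z using that by auto
      show "cauchy_transform h z = 0" if "z \<in> {z. Im z < 0} - {cnj w}" for z
        using that transform_h[of z] transform_p[of z] lower[OF w, of z] lower[OF v, of z] by auto
    qed
    then have "cauchy_transform h u = (\<integral>x. 0 \<partial>(lborel :: real measure))"
      unfolding cauchy_transform_def using sqh
      by (intro integral_cong_AE) (auto elim: eventually_mono simp: square_integrable_def)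
    then have "cauchy_transform (\<phi> w) u = cauchy_transform (\<phi> v) u + (cnj w - cnj v) * cauchy_transform ?p u"
      using transform_h[of u] u by simp
    then have "(cnj w - u) * cauchy_transform (\<phi> w) u =
        (cnj w - u) * cauchy_transform (\<phi> v) u + (cnj w - cnj v) * ((cnj w - u) * cauchy_transform ?p u)"
      by (simp only: distrib_left mult.left_commute)
    also have "\<dots> = (cnj v - u) * cauchy_transform (\<phi> v) u"
      unfolding transform_p[OF less_imp_neq[OF u, symmetric]] by (simp add: algebra_simps)
    finally show ?thesis by (simp add: algebra_simps)
  qed
  \<comment> \<open>The value for \<open>w = \<i>\<close>, which represents the value for all \<open>w\<close>.\<close>
  define m where "m v = (v + \<i>) * cauchy_transform (\<phi> \<i>) v" for v
  have m: "(v - cnj w) * cinner (A (szego_kernel w)) (szego_kernel v) = m v" if "Im w > 0" "Im v > 0" for w v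
    using indep[of w "\<i>" v] that by (simp add: m_def cinner_szego_kernel \<phi>_def)
  \<comment> \<open>The sign comes from conjugating the factor \<open>w - cnj v\<close>.\<close>
  have reflect: "cnj (m w) = - m v" if "Im w > 0" "Im v > 0" for w v
  proof -
    have eq: "cinner (A (szego_kernel w)) (szego_kernel v) = cnj (cinner (A (szego_kernel v)) (szego_kernel w))"
      using A(2) cinner_commute by (metis selfadjoint_def)
    have "cnj (m w) = (cnj w - v) * cinner (A (szego_kernel w)) (szego_kernel v)"
      unfolding eq m[OF that(2,1), symmetric] by simp
    also have "\<dots> = - m v"
      unfolding m[OF that, symmetric] by (simp add: algebra_simps)
    finally show ?thesis .
  qed
  have "m v = m \<i>" if "Im v > 0" for v
    using reflect[of "\<i>" v] reflect[of "\<i>" "\<i>"] that by simp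
  with m have "(v - cnj w) * cinner (A (szego_kernel w)) (szego_kernel v) = m \<i>"
    if "Im w > 0" "Im v > 0" for w v using that by metis
  moreover have "cnj (m \<i>) = - m \<i>" by (rule reflect) simp_all
  ultimately show ?thesis by (rule that[rotated])
qed

lemma id_in_Alg: "(\<lambda>f. f) \<in> Alg \<L>"
  by (auto simp: Alg_def bounded_clinear_def bounded_linear_ident)

theorem theorem3p2:
  fixes A :: "L2R \<Rightarrow> L2R"
  assumes "A \<in> Alg subspace_lattice" and "selfadjoint A"
  shows "\<exists>c::real. A = (\<lambda>f. c *\<^sub>R f)"
proof -
  obtain \<mu> where \<mu>: "cnj \<mu> = - \<mu>"
    "\<And>w v. Im w > 0 \<Longrightarrow> Im v > 0 \<Longrightarrow> (v - cnj w) * cinner (A (szego_kernel w)) (szego_kernel v) = \<mu>"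
    using selfadjoint_Alg_szego_kernel[OF assms] by blast
  have "selfadjoint (\<lambda>f. f)" by (simp add: selfadjoint_def)
  then obtain \<nu> where \<nu>: "cnj \<nu> = - \<nu>"
    "\<And>w v. Im w > 0 \<Longrightarrow> Im v > 0 \<Longrightarrow> (v - cnj w) * cinner (szego_kernel w) (szego_kernel v) = \<nu>"
    using selfadjoint_Alg_szego_kernel[OF id_in_Alg] by blast
  have "\<nu> \<noteq> 0"
    using \<nu>(2)[of "\<i>" "\<i>"] szego_kernel_nonzero[of "\<i>"] by (auto simp: cinner_self(3))
  \<comment> \<open>The quotient of two imaginary numbers is real.\<close>
  define c where "c = Re (\<mu> / \<nu>)"
  have "cnj (\<mu> / \<nu>) = \<mu> / \<nu>" using \<mu>(1) \<nu>(1) by simp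
  then have c: "of_real c * \<nu> = \<mu>"
    using \<open>\<nu> \<noteq> 0\<close> by (metis c_def Reals_cnj_iff of_real_Re nonzero_eq_divide_eq)
  have H2: "A f \<in> H2" if "f \<in> H2" for f
    using assms(1) H2_in_subspace_lattice that by (auto simp: Alg_def)
  have eigen: "A (szego_kernel w) = c *\<^sub>R szego_kernel w" if w: "Im w > 0" for w
  proof -
    have "A (szego_kernel w) - c *\<^sub>R szego_kernel w = 0"
    proof (rule szego_kernel_total)
      fix v :: complex
      assume "Im v \<noteq> 0"
      then consider "Im v > 0" | "Im v < 0" by linarith
      then show "cinner (A (szego_kernel w) - c *\<^sub>R szego_kernel w) (szego_kernel v) = 0"
      proof cases
        case 1
        have "(v - cnj w) * cinner (A (szego_kernel w) - c *\<^sub>R szego_kernel w) (szego_kernel v) = \<mu> - of_real c * \<nu>"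
          using \<mu>(2)[OF w 1] \<nu>(2)[OF w 1] by (simp add: cinner_diff_left cinner_scaleR_left algebra_simps)
        moreover have "v - cnj w \<noteq> 0" using w 1 by (auto simp: complex_eq_iff)
        ultimately show ?thesis using c by simp
      next
        case 2
        then show ?thesis
          using szego_kernel_in_H2[OF w] H2[of "szego_kernel w"]
          by (simp add: cinner_diff_left cinner_scaleR_left H2_orthogonal_lower_szego_kernel)
      qed
    qed
    then show ?thesis by simp
  qed
  have "A f = c *\<^sub>R f" for f
  proof -
    have "A f - c *\<^sub>R f = 0"
    proof (rule upper_szego_kernel_total)
      show "cinner (A f - c *\<^sub>R f) (szego_kernel v) = 0" if "Im v > 0" for v
        using assms(2) eigen[OF that]
        by (simp add: selfadjoint_def cinner_diff_left cinner_scaleR_left cinner_scaleR_right)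
      have "AE x in lborel. rep_L2R (szego_kernel \<i>) x = cauchy_kernel (cnj \<i>) x"
        by (rule rep_szego_kernel) simp
      with selfadjoint_Alg_local[OF assms, of f "szego_kernel \<i>"]
        rep_scaleR[of c "szego_kernel \<i>"] rep_scaleR[of c f] rep_diff[of "A f" "c *\<^sub>R f"]
      show "AE x in lborel. x < 0 \<longrightarrow> rep_L2R (A f - c *\<^sub>R f) x = 0"
      proof eventually_elim
        case (elim x)
        have "cauchy_kernel (cnj \<i>) x \<noteq> 0" by (rule cauchy_kernel_nonzero) simp
        with elim eigen[of "\<i>"] show ?case by (auto simp: mult.commute)
      qed
    qed
    then show ?thesis by simp
  qed
  then show ?thesis by blast
qed

end
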